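(* Let $$K:=\sup_{N\in\mathbb N}\big\|P_1:H^1_{\mathrm{all}}(\mathbb T^N)\to H^1_{\mathrm{all}}(\mathbb T^N)\big\|.$$ Then $K<\infty$, and for every $m\ge1$, $P_m$ maps $H^1_{\mathrm{all}}(\mathbb T^N)$ into itself with $$\sup_{N}\big\|P_m:H^1_{\mathrm{all}}(\mathbb T^N)\to H^1_{\mathrm{all}}(\mathbb T^N)\big\|\le\frac1e\,(eK)^m.$$ Consequently $P_m$ extends to a bounded operator on $H^1_{\mathrm{all}}(\mathbb T^{\mathbb N})$ (equivalently, the projection from the Hardy space $\mathcal H^1$ of Dirichlet series onto the closed span of $n^{-s}$ with $n$ having exactly $m$ distinct prime factors is bounded).
   Context: $\mathbb T=[0,2\pi)$ with normalized Lebesgue measure; $\mathbb T^N$ ($N\in\mathbb N\cup\{\infty\}$) has the product measure. $H^1_{\mathrm{all}}(\mathbb T^N)$ (also written $H^1(\mathbb D^N)$) is the closed span in $L^1(\mathbb T^N)$ of the characters $e^{i\langle n,t\rangle}$ with $n$ finitely supported and $n_j\ge0$ for all $j$. $P_m$ is the Fourier multiplier with $P_m e^{i\langle n,t\rangle}=e^{i\langle n,t\rangle}$ if $|\operatorname{supp}n|=m$ and $=0$ otherwise; this coincides with the Hoeffding projection $P_m=\sum_{|A|=m}P_A$, $P_A=(\mathrm{id}-\mathbb E)^{\otimes A}\otimes\mathbb E^{\otimes(\text{complement of }A)}$. *)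

theory Defs
  imports "HOL-Probability.Probability"
begin

text \<open>The torus T^I (I a set of coordinates, I = {..<N} or I = UNIV for T^infinity),
  with the product of normalized Lebesgue measure on [0, 2 pi).\<close>
definition torus :: "nat set \<Rightarrow> (nat \<Rightarrow> real) measure" where
  "torus I = PiM I (\<lambda>_. uniform_measure lborel {0..<2*pi})"

definition supp :: "(nat \<Rightarrow> int) \<Rightarrow> nat set" where
  "supp n = {j. n j \<noteq> 0}"

definition mindex :: "nat set \<Rightarrow> (nat \<Rightarrow> int) set" where
  "mindex I = {n. finite (supp n) \<and> supp n \<subseteq> I}"

definition amindex :: "nat set \<Rightarrow> (nat \<Rightarrow> int) set" where
  "amindex I = {n \<in> mindex I. \<forall>j. n j \<ge> 0}"

definition character :: "(nat \<Rightarrow> int) \<Rightarrow> (nat \<Rightarrow> real) \<Rightarrow> complex" where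
  "character n t = cis (\<Sum>j\<in>supp n. real_of_int (n j) * t j)"

definition fourier :: "nat set \<Rightarrow> ((nat \<Rightarrow> real) \<Rightarrow> complex) \<Rightarrow> (nat \<Rightarrow> int) \<Rightarrow> complex" where
  "fourier I f n = (LINT t|torus I. f t * cnj (character n t))"

definition l1norm :: "nat set \<Rightarrow> ((nat \<Rightarrow> real) \<Rightarrow> complex) \<Rightarrow> real" where
  "l1norm I f = (LINT t|torus I. cmod (f t))"

definition apoly :: "nat set \<Rightarrow> ((nat \<Rightarrow> real) \<Rightarrow> complex) \<Rightarrow> bool" where
  "apoly I f \<longleftrightarrow> (\<exists>F c. finite F \<and> F \<subseteq> amindex I \<and>
      (\<forall>t\<in>space (torus I). f t = (\<Sum>n\<in>F. c n * character n t)))"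

definition H1 :: "nat set \<Rightarrow> ((nat \<Rightarrow> real) \<Rightarrow> complex) set" where
  "H1 I = {f. integrable (torus I) f \<and>
      (\<forall>\<epsilon>>0. \<exists>p. apoly I p \<and> l1norm I (\<lambda>t. f t - p t) < \<epsilon>)}"

text \<open>g is (a representative of) P_m f: the Fourier multiplier keeping exactly
  the frequencies whose support has m elements.\<close>
definition is_Pm :: "nat set \<Rightarrow> nat \<Rightarrow> ((nat \<Rightarrow> real) \<Rightarrow> complex) \<Rightarrow> ((nat \<Rightarrow> real) \<Rightarrow> complex) \<Rightarrow> bool" where
  "is_Pm I m f g \<longleftrightarrow> integrable (torus I) g \<and>
     (\<forall>n\<in>mindex I. fourier I g n = (if card (supp n) = m then fourier I f n else 0))"

text \<open>K = sup_N ||P_1 : H^1(T^N) -> H^1(T^N)||, computed on the dense subspace of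
  analytic polynomials (where P_1 is trivially defined), as an extended real.\<close>
definition K_P1 :: ereal where
  "K_P1 = (SUP x\<in>{l1norm {..<N} g / l1norm {..<N} f | N f g.
              apoly {..<N} f \<and> l1norm {..<N} f \<noteq> 0 \<and> is_Pm {..<N} 1 f g}. ereal x)"

end

theory Submission
  imports Defs "HOL-Complex_Analysis.Complex_Analysis"
    "HOL-Computational_Algebra.Fundamental_Theorem_Algebra"
begin

text \<open>
  Boundedness of P_1. For an analytic polynomial f on the circle with mean x, zeros can be
  reflected in the circle, which gives E sqrt|f| \<ge> sqrt|x|. Together with E f = x this bounds the
  oscillation of f around x by E|f| - |x|, and yields
  E|(f(s), y + f(s') - x)| \<le> |(x, y)| + C (E|f| - |x|) for independent s, s'.
  Adding the variables one at a time, and averaging out by Jensen's inequality the copy s of the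
  variable on which P_1 does not depend, one obtains
  E|(E f, y + P_1 f)| \<le> |(E f, y)| + C (E|f| - |E f|) on every finite-dimensional torus.

  Boundedness of P_m. Colour the variables with m colours. The composition of the projections P_1
  acting on the m colour classes has norm at most K^m and keeps exactly the characters whose support
  meets every class in one point. Averaging over all colourings gives (m!/m^m) P_m, so
  ||P_m|| \<le> (m^m/m!) K^m \<le> e^(m-1) K^m. Passing to H^1 is a density argument.
\<close>

section \<open>Analytic polynomials on the circle\<close>

text \<open>No bound uniform in N holds on all of L^1: the products of 1 + cos t_j have norm 1,
  while P_1 sends them to the sum of the cos t_j, whose norm grows like sqrt N. For such nonnegative
  f the gap E|f| - |E f| vanishes although f oscillates; the lower bound for E sqrt|f| is where
  analyticity excludes this. The constant does not grow with N because each variable is paid for by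
  an increment of the mean modulus of a conditional expectation, and these increments telescope.
  This requires coefficient 1 in front of |(E f, y)| and an error linear in the gap. Keeping E f
  beside y + P_1 f helps since |(x, y)| \<ge> |x| bounds the curvature of the norm at (x, y) by
  1/|x| for every y; the arbitrary y absorbs the contribution of a variable that has been split off.
  Two independent copies s, s' occur because the conditional mean at s is the constant term of the
  slice handed to the remaining variables, whereas P_1 f sees the split-off variable only through
  s'.\<close>

abbreviation unif :: "real measure" where
  "unif \<equiv> uniform_measure lborel {0..<2*pi}"

lemma prob_space_unif: "prob_space unif"
  by (rule prob_space_uniform_measure) auto

interpretation unif: prob_space unif
  by (rule prob_space_unif)

lemma integrable_unif_continuous:
  fixes f :: "real \<Rightarrow> 'a::{banach, second_countable_topology}"
  assumes "continuous_on UNIV f" "\<And>s. norm (f s) \<le> B"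
  shows "integrable unif f"
  using assms borel_measurable_continuous_onI[OF assms(1)]
  by (intro unif.integrable_const_bound[where B = B]) auto

lemma integral_unif_eq:
  fixes f :: "real \<Rightarrow> complex"
  assumes "continuous_on UNIV f"
  shows "(LINT s|unif. f s) = integral {0..2*pi} f / (2*pi)"
proof -
  have m [measurable]: "f \<in> borel_measurable borel"
    using assms by (rule borel_measurable_continuous_onI)
  have "(LINT s|unif. f s) = (LINT s|density lborel (\<lambda>s. ennreal (indicator {0..<2*pi} s / (2*pi))). f s)"
    by (simp add: uniform_measure_def ennreal_indicator[symmetric] divide_ennreal)
  also have "\<dots> = (LINT s|lborel. (indicator {0..<2*pi} s / (2*pi)) *\<^sub>R f s)"
    by (subst integral_density) auto
  also have "\<dots> = (LINT s|lborel. (indicator {0..2*pi} s / (2*pi)) *\<^sub>R f s)"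
    by (intro integral_cong_AE) (auto intro!: AE_I'[of "{2*pi}"] simp: indicator_def)
  also have "\<dots> = (LINT s|lborel. (1 / (2*pi)) *\<^sub>R (indicator {0..2*pi} s *\<^sub>R f s))"
    by (intro Bochner_Integration.integral_cong) auto
  also have "\<dots> = (1 / (2*pi)) *\<^sub>R (LINT s:{0..2*pi}|lborel. f s)"
    unfolding set_lebesgue_integral_def by (rule integral_scaleR_right)
  also have "(LINT s:{0..2*pi}|lborel. f s) = integral {0..2*pi} f"
    using assms by (intro set_borel_integral_eq_integral borel_integrable_atLeastAtMost')
      (auto intro: continuous_on_subset)
  finally show ?thesis
    by (simp add: scaleR_conv_of_real)
qed

text \<open>Only continuity is asked for on the boundary, because the square roots used below may
  vanish on the circle, where they are not holomorphic. The identity is Cauchy's formula at the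
  centre; multiplying by -\<i> cancels the factor \<i> of the parametrization.\<close>

lemma circle_mean_value:
  assumes cont: "continuous_on (cball 0 1) g" and hol: "g holomorphic_on ball 0 1"
  shows "(LINT s|unif. g (cis s)) = g 0"
proof -
  have "((\<lambda>u. g u / (u - 0)) has_contour_integral (2 * of_real pi * \<i> * g 0)) (circlepath 0 1)"
    by (rule Cauchy_integral_circlepath[OF cont hol]) simp
  hence "((\<lambda>t. g (cis t) / cis t * \<i> * cis t) has_integral (2 * of_real pi * \<i> * g 0)) {0..2*pi}"
    unfolding circlepath_def
    by (subst (asm) has_contour_integral_part_circlepath_iff) auto
  hence "((\<lambda>t. (g (cis t) / cis t * \<i> * cis t) * (-\<i>)) has_integral (2 * of_real pi * \<i> * g 0) * (-\<i>)) {0..2*pi}"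
    by (rule has_integral_mult_left)
  hence "((\<lambda>t. g (cis t)) has_integral (2 * of_real pi * g 0)) {0..2*pi}"
    by (simp add: field_simps)
  moreover have "continuous_on UNIV (\<lambda>s. g (cis s))"
    by (rule continuous_on_compose2[OF cont]) (auto intro!: continuous_intros)
  ultimately show ?thesis
    by (simp add: integral_unif_eq integral_unique)
qed

lemma integral_unif_cis: "(LINT s|unif. cis (real_of_int k * s)) = (if k = 0 then 1 else 0)"
proof (cases "k \<ge> 0")
  case True
  have "(LINT s|unif. cis s ^ nat k) = 0 ^ nat k"
    by (intro circle_mean_value[of "\<lambda>z. z ^ nat k"]) (auto intro!: continuous_intros holomorphic_intros)
  thus ?thesis
    using True by (simp add: Complex.DeMoivre power_0_left)
next
  case False
  have "(LINT s|unif. cis s ^ nat (-k)) = 0 ^ nat (-k)"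
    by (intro circle_mean_value[of "\<lambda>z. z ^ nat (-k)"]) (auto intro!: continuous_intros holomorphic_intros)
  hence *: "(LINT s|unif. cis (- (real_of_int k * s))) = 0"
    using False by (simp add: Complex.DeMoivre power_0_left)
  have "(LINT s|unif. cis (real_of_int k * s)) = (LINT s|unif. cnj (cis (- (real_of_int k * s))))"
    by (simp add: cis_cnj)
  also have "\<dots> = 0"
    by (subst Bochner_Integration.integral_cnj) (use * in \<open>simp del: cis_cnj\<close>)
  finally show ?thesis using False by simp
qed

section \<open>Holomorphic square roots of polynomials on the closed disc\<close>

lemma isCont_csqrt_0: "isCont csqrt 0"
proof -
  have "((\<lambda>z. norm (csqrt z)) \<longlongrightarrow> 0) (at 0)"
    using tendsto_real_sqrt[OF tendsto_norm_zero[OF tendsto_ident_at[of "0::complex" UNIV]]]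
    by (simp add: norm_csqrt)
  thus ?thesis
    unfolding isCont_def by (subst (asm) tendsto_norm_zero_iff) simp
qed

text \<open>The values 1 - b z have nonnegative real part, so they meet the branch cut of
  \<open>csqrt\<close> at most in its endpoint 0. There \<open>csqrt\<close> is continuous without
  being holomorphic, and within the closed disc 0 is reached only for norm z = 1.\<close>

lemma csqrt_one_minus:
  fixes b :: complex
  assumes "norm b \<le> 1"
  shows "continuous_on (cball 0 1) (\<lambda>z. csqrt (1 - b * z))"
    and "(\<lambda>z. csqrt (1 - b * z)) holomorphic_on ball 0 1"
proof -
  have Re: "1 - norm z \<le> Re (1 - b * z)" for z
  proof -
    have "Re (b * z) \<le> norm (b * z)" by (rule complex_Re_le_cmod)
    also have "\<dots> \<le> 1 * norm z" unfolding norm_mult using assms by (intro mult_right_mono) auto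
    finally show ?thesis by simp
  qed
  have *: "isCont csqrt w" if "Re w \<ge> 0" for w
  proof (cases "w = 0")
    case False
    hence "w \<notin> \<real>\<^sub>\<le>\<^sub>0"
      using that by (auto simp: complex_nonpos_Reals_iff complex_eq_iff)
    thus ?thesis by (rule continuous_at_csqrt)
  qed (use isCont_csqrt_0 in simp)
  have cont: "continuous_on {w. Re w \<ge> 0} csqrt"
    using * by (auto intro: continuous_at_imp_continuous_on)
  have "(\<lambda>z. 1 - b * z) ` cball 0 1 \<subseteq> {w. Re w \<ge> 0}"
  proof (intro image_subsetI CollectI)
    fix z :: complex assume "z \<in> cball 0 1"
    thus "Re (1 - b * z) \<ge> 0" using Re[of z] by simp
  qed
  thus "continuous_on (cball 0 1) (\<lambda>z. csqrt (1 - b * z))"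
    by (rule continuous_on_compose2[OF cont, rotated]) (intro continuous_intros)
  have "1 - b * z \<notin> \<real>\<^sub>\<le>\<^sub>0" if "norm z < 1" for z
    using Re[of z] that by (auto simp: complex_nonpos_Reals_iff)
  thus "(\<lambda>z. csqrt (1 - b * z)) holomorphic_on ball 0 1"
    by (intro holomorphic_intros) auto
qed

text \<open>Zeros in the disc are reflected in the circle. This does not change the modulus on the
  circle and makes a holomorphic square root available.\<close>
lemma sqrt_poly_eq_norm_holomorphic:
  fixes p :: "complex poly"
  shows "\<exists>g. continuous_on (cball 0 1) g \<and> g holomorphic_on ball 0 1 \<and>
           (\<forall>z. norm z = 1 \<longrightarrow> norm (g z) = sqrt (norm (poly p z))) \<and>
           sqrt (norm (poly p 0)) \<le> norm (g 0)" (is "\<exists>g. ?P p g")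
proof -
  have linear: "\<exists>g. ?P [:-a, 1:] g" for a :: complex
  proof (cases "norm a \<le> 1")
    case True
    have "norm (csqrt (1 - cnj a * z)) = sqrt (norm (poly [:-a, 1:] z))" if "norm z = 1" for z
    proof -
      \<comment> \<open>On the circle the reflected factor equals the conjugate of the original one
        up to the unimodular z. At the centre it is 1, which is at least sqrt (norm a).\<close>
      have "1 = z * cnj z" using that by (simp add: complex_norm_square[symmetric])
      hence "1 - cnj a * z = z * cnj (z - a)" by (simp add: algebra_simps)
      hence "norm (1 - cnj a * z) = norm (z - a)"
        using that by (metis complex_mod_cnj mult_1 norm_mult)
      thus ?thesis by (simp add: norm_csqrt)
    qed
    thus ?thesis
      using True csqrt_one_minus[of "cnj a"]
      by (intro exI[of _ "\<lambda>z. csqrt (1 - cnj a * z)"]) auto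
  next
    case False
    hence a: "norm (inverse a) \<le> 1" "a \<noteq> 0"
      by (auto simp: norm_inverse intro: inverse_le_1_iff[THEN iffD2])
    \<comment> \<open>A zero outside the closed disc is not reflected; pulling out \<open>a\<close>
      leaves 1 - b z with norm b \<le> 1, as \<open>csqrt_one_minus\<close> requires.\<close>
    have "norm (csqrt a * csqrt (1 - inverse a * z)) = sqrt (norm (poly [:-a, 1:] z))" for z
    proof -
      have "a * (1 - inverse a * z) = a - z" using a by (simp add: algebra_simps)
      hence "norm a * norm (1 - inverse a * z) = norm (z - a)"
        by (metis norm_minus_commute norm_mult)
      thus ?thesis by (simp add: norm_mult norm_csqrt flip: real_sqrt_mult)
    qed
    thus ?thesis
      using csqrt_one_minus[OF a(1)]
      by (intro exI[of _ "\<lambda>z. csqrt a * csqrt (1 - inverse a * z)"])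
        (auto intro!: continuous_intros holomorphic_intros)
  qed
  have mult: "\<exists>g. ?P (p * q) g" if "\<exists>g. ?P p g" "\<exists>g. ?P q g" for p q
  proof -
    from that obtain g h where "?P p g" "?P q h" by blast
    thus ?thesis
      by (intro exI[of _ "\<lambda>z. g z * h z"])
        (auto intro!: continuous_intros holomorphic_intros mult_mono simp: norm_mult real_sqrt_mult)
  qed
  have const: "\<exists>g. ?P [:c:] g" for c
    by (intro exI[of _ "\<lambda>_. csqrt c"]) (auto intro!: continuous_intros holomorphic_intros simp: norm_csqrt)
  show ?thesis
  proof (cases "p = 0")
    case False
    then obtain A where "p = smult (lead_coeff p) (\<Prod>x\<in>#A. [:-x, 1:])"
      using alg_closed_imp_factorization[of p] by metis
    moreover have "\<exists>g. ?P (\<Prod>x\<in>#A. [:-x, 1:]) g"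
    proof (induction A)
      case empty
      show ?case using const[of 1] by (simp add: one_pCons)
    next
      case (add x A)
      show ?case using mult[OF linear[of x] add.IH] by simp
    qed
    ultimately show ?thesis
      using mult[OF const[of "lead_coeff p"], of "\<Prod>x\<in>#A. [:-x, 1:]"] by simp
  qed (use const[of 0] in simp)
qed

text \<open>This is subharmonicity of |p|^(1/2) at the centre, read off from |g(0)| \<le> E|g| for
  the holomorphic g with |g| = sqrt|p| on the circle. The exponent 1/2, being below 1, is what gives
  more than the trivial |p(0)| \<le> E|p|.\<close>

lemma mean_sqrt_poly_ge:
  fixes p :: "complex poly"
  shows "sqrt (norm (poly p 0)) \<le> (LINT s|unif. sqrt (norm (poly p (cis s))))"
proof -
  obtain g where g: "continuous_on (cball 0 1) g" "g holomorphic_on ball 0 1"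
      "\<And>z. norm z = 1 \<Longrightarrow> norm (g z) = sqrt (norm (poly p z))" "sqrt (norm (poly p 0)) \<le> norm (g 0)"
    using sqrt_poly_eq_norm_holomorphic[of p] by blast
  note g(4)
  also have "g 0 = (LINT s|unif. g (cis s))"
    using circle_mean_value[OF g(1,2)] ..
  also have "norm \<dots> \<le> (LINT s|unif. norm (g (cis s)))"
    by (rule integral_norm_bound)
  finally show ?thesis by (simp add: g(3))
qed

section \<open>A second-order estimate for the norm of a pair, with the error measured by the
  defect\<close>

lemma norm_add_le_taylor:
  fixes v w :: "'a::real_inner"
  assumes "v \<noteq> 0"
  shows "norm (v + w) \<le> norm v + inner v w / norm v + min ((norm w)\<^sup>2 / (2 * norm v)) (2 * norm w)"
proof -
  have v: "norm v > 0" using assms by simp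
  \<comment> \<open>The inequality 2ab \<le> a^2 + b^2 with b = norm v trades the norm for its
    square, which expands exactly.\<close>
  have "2 * norm (v + w) * norm v \<le> (norm (v + w))\<^sup>2 + (norm v)\<^sup>2"
    using sum_squares_bound[of "norm (v + w)" "norm v"] by simp
  also have "\<dots> = 2 * (norm v)\<^sup>2 + 2 * inner v w + (norm w)\<^sup>2"
    by (simp add: power2_norm_eq_inner inner_add_left inner_add_right inner_commute)
  finally have 1: "norm (v + w) \<le> norm v + inner v w / norm v + (norm w)\<^sup>2 / (2 * norm v)"
    using v by (simp add: field_simps power2_eq_square)
  \<comment> \<open>For large w the triangle inequality is better; the linear term can be as low as
    - norm w, so compensating for it doubles norm w.\<close>
  have "- (norm v * norm w) \<le> inner v w"
    using Cauchy_Schwarz_ineq2[of v w] by linarith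
  hence "- norm w \<le> inner v w / norm v"
    using v by (simp add: field_simps)
  moreover have "norm (v + w) \<le> norm v + norm w"
    by (rule norm_triangle_ineq)
  ultimately show ?thesis
    using 1 by (simp add: min_def)
qed

text \<open>The defect has two parts: the first controls how far the modulus moves, the second how
  far the argument moves. Both have small mean along an analytic polynomial.\<close>
definition defect :: "complex \<Rightarrow> complex \<Rightarrow> real" where
  "defect x w = (sqrt (norm w) - sqrt (norm x))\<^sup>2 + (norm w - inner x w / norm x)"

text \<open>The deviation is measured quadratically when norm (x + a) \<le> 4 * norm x and linearly
  beyond that. The constant 9 is the square in r + X \<le> 3 * X of the quadratic regime; in the
  other regime already 5 would do.\<close>

lemma min_le_defect:
  assumes "x \<noteq> 0"
  shows "min ((norm a)\<^sup>2 / norm x) (norm a) \<le> 9 * defect x (x + a)"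
proof -
  define X where "X = sqrt (norm x)"
  define r where "r = sqrt (norm (x + a))"
  have X: "X > 0" "norm x = X\<^sup>2" and r: "r \<ge> 0" "norm (x + a) = r\<^sup>2"
    using assms by (auto simp: X_def r_def)
  define q where "q = r\<^sup>2 - inner x (x + a) / X\<^sup>2"
  have D: "defect x (x + a) = (r - X)\<^sup>2 + q"
    unfolding defect_def q_def using X r by simp
  have "inner x (x + a) \<le> norm x * norm (x + a)"
    by (rule norm_cauchy_schwarz)
  hence q: "q \<ge> 0"
    unfolding q_def using X r by (simp add: field_simps)
  show ?thesis
  proof (cases "r \<le> 2 * X")
    case True
    \<comment> \<open>The square of norm a is exactly (r^2 - X^2)^2 + 2 * X^2 * q: an error of
      modulus plus an error of argument.\<close>
    have "(norm a)\<^sup>2 = (norm (x + a))\<^sup>2 + (norm x)\<^sup>2 - 2 * inner x (x + a)"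
      by (simp add: power2_norm_eq_inner inner_add_left inner_add_right inner_commute)
    also have "\<dots> = (r - X)\<^sup>2 * (r + X)\<^sup>2 + 2 * X\<^sup>2 * q"
      unfolding q_def X r using X(1) by (simp add: field_simps power2_eq_square)
    also have "\<dots> \<le> (r - X)\<^sup>2 * (9 * X\<^sup>2) + 9 * X\<^sup>2 * q"
    proof (intro add_mono mult_left_mono mult_right_mono)
      have "(r + X)\<^sup>2 \<le> (3 * X)\<^sup>2" using True X r by (intro power_mono) auto
      thus "(r + X)\<^sup>2 \<le> 9 * X\<^sup>2" by (simp add: power_mult_distrib)
    qed (use q in auto)
    also have "\<dots> = 9 * defect x (x + a) * norm x"
      unfolding D X by (simp add: algebra_simps)
    finally have "(norm a)\<^sup>2 / norm x \<le> 9 * defect x (x + a)"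
      using assms by (simp add: field_simps)
    thus ?thesis by simp
  next
    case False
    have "norm a \<le> norm (x + a) + norm x"
      using norm_triangle_ineq4[of "x + a" x] by simp
    also have "\<dots> \<le> r\<^sup>2 + (r/2)\<^sup>2"
      unfolding X r using False X by (intro add_mono power_mono) auto
    also have "\<dots> \<le> 9 * (r/2)\<^sup>2"
      by (simp add: power2_eq_square)
    also have "(r/2)\<^sup>2 \<le> (r - X)\<^sup>2"
      using False X r by (intro power_mono) auto
    finally show ?thesis
      unfolding D using q by (simp add: min_def)
  qed
qed

lemma defect_nonneg: "defect x w \<ge> 0"
proof -
  have "inner x w \<le> norm x * norm w" by (rule norm_cauchy_schwarz)
  hence "inner x w / norm x \<le> norm w"
    by (cases "x = 0") (auto simp: field_simps)
  thus ?thesis unfolding defect_def by simp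
qed

text \<open>Both increments are controlled by defects relative to x alone, since norm (x, y) \<ge>
  norm x lets norm x replace it in the denominator of the quadratic error. The constant is 27 = 3 *
  9; the 3 is 2 * (3/2), where 3/2 is a rational bound for sqrt 2 in comparing (h, h') with the
  larger of norm h and norm h'.\<close>

lemma norm_pair_add_le:
  fixes x y h h' :: complex
  assumes "x \<noteq> 0"
  shows "norm (x + h, y + h') \<le> norm (x, y) + (inner x h + inner y h') / norm (x, y)
           + 27 * (defect x (x + h) + defect x (x + h'))"
proof -
  have xy: "(x, y) \<noteq> 0" and le: "norm x \<le> norm (x, y)"
    using assms norm_fst_le[of x y] by (auto simp: zero_prod_def)
  have x: "norm x > 0" using assms by simp
  define M where "M = max (norm h) (norm h')"
  have M: "M \<ge> 0" unfolding M_def by (simp add: le_max_iff_disj)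
  have "(norm h)\<^sup>2 \<le> M\<^sup>2" "(norm h')\<^sup>2 \<le> M\<^sup>2"
    unfolding M_def by (auto intro!: power_mono)
  hence w2: "(norm (h, h'))\<^sup>2 \<le> 2 * M\<^sup>2"
    unfolding norm_Pair by simp
  have "(norm (h, h'))\<^sup>2 \<le> (3/2 * M)\<^sup>2"
    using order_trans[OF w2, of "9/4 * M\<^sup>2"] zero_le_power2[of M]
    unfolding power_mult_distrib power_divide by (auto intro: order_trans)
  hence w1: "norm (h, h') \<le> 3/2 * M"
    by (rule power2_le_imp_le) (use M in simp)
  have "(norm (h, h'))\<^sup>2 / (2 * norm (x, y)) \<le> (2 * M\<^sup>2) / (2 * norm x)"
    using w2 le x by (intro frac_le) auto
  also have "\<dots> \<le> 3 * (M\<^sup>2 / norm x)"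
    using x by (simp add: field_simps)
  finally have "min ((norm (h, h'))\<^sup>2 / (2 * norm (x, y))) (2 * norm (h, h')) \<le> 3 * min (M\<^sup>2 / norm x) M"
    using w1 unfolding min_def by auto
  also have "min (M\<^sup>2 / norm x) M \<le> 9 * (defect x (x + h) + defect x (x + h'))"
    using min_le_defect[OF assms, of h] min_le_defect[OF assms, of h']
      defect_nonneg[of x "x + h"] defect_nonneg[of x "x + h'"]
    unfolding M_def max_def by (auto split: if_splits)
  finally show ?thesis
    using norm_add_le_taylor[OF xy, of "(h, h')"] by simp
qed

section \<open>Means along an analytic polynomial on the circle\<close>

lemma bounded_poly_cis: "\<exists>B. \<forall>s. norm (poly p (cis s)) \<le> B"
proof -
  have "compact (poly p ` sphere 0 1)"
    by (intro compact_continuous_image continuous_intros compact_sphere)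
  hence "bounded (poly p ` sphere 0 1)" by (rule compact_imp_bounded)
  then obtain B where "\<forall>z\<in>sphere 0 1. norm (poly p z) \<le> B"
    by (auto simp: bounded_iff)
  thus ?thesis by (intro exI[of _ B]) auto
qed

lemma integrable_poly_cis: "integrable unif (\<lambda>s. poly p (cis s))"
  using bounded_poly_cis[of p] by (auto intro!: integrable_unif_continuous continuous_intros)

lemma integral_poly_cis: "(LINT s|unif. poly p (cis s)) = poly p 0"
  by (rule circle_mean_value) (auto intro!: continuous_intros holomorphic_intros)

lemma integrable_sqrt_poly_cis: "integrable unif (\<lambda>s. sqrt (norm (poly p (cis s))))"
proof -
  obtain B where "\<And>s. norm (poly p (cis s)) \<le> B" using bounded_poly_cis by blast
  thus ?thesis
    by (intro integrable_unif_continuous[where B = "sqrt B"]) (auto intro!: continuous_intros)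
qed

text \<open>In this form the mean can be taken term by term, and only the term with sqrt (norm w)
  calls for an inequality.\<close>

lemma defect_expand:
  "defect x w = 2 * norm w - 2 * sqrt (norm x) * sqrt (norm w) + norm x - inner x w / norm x"
  unfolding defect_def by (simp add: power2_diff)

lemma integrable_defect_poly: "integrable unif (\<lambda>s. defect x (poly p (cis s)))"
  unfolding defect_expand
  by (intro Bochner_Integration.integrable_add Bochner_Integration.integrable_diff
      integrable_mult_right integrable_divide integrable_inner_right integrable_norm
      integrable_poly_cis integrable_sqrt_poly_cis) auto

text \<open>The mean of the inner product term is norm x and cancels the summand norm x. What
  remains is 2 E|f| - 2 sqrt|x| E sqrt|f|, to which \<open>mean_sqrt_poly_ge\<close>
  applies.\<close>

lemma integral_defect_poly_le:
  assumes "poly p 0 \<noteq> 0"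
  shows "(LINT s|unif. defect (poly p 0) (poly p (cis s)))
           \<le> 2 * ((LINT s|unif. norm (poly p (cis s))) - norm (poly p 0))"
proof -
  let ?x = "poly p 0"
  have "(LINT s|unif. defect ?x (poly p (cis s))) =
      2 * (LINT s|unif. norm (poly p (cis s)))
      - 2 * sqrt (norm ?x) * (LINT s|unif. sqrt (norm (poly p (cis s)))) + norm ?x
      - inner ?x (LINT s|unif. poly p (cis s)) / norm ?x"
    unfolding defect_expand
    using integrable_poly_cis[of p] integrable_sqrt_poly_cis[of p] unif.prob_space
    by simp
  also have "inner ?x (LINT s|unif. poly p (cis s)) / norm ?x = norm ?x"
    using assms by (simp add: integral_poly_cis power2_norm_eq_inner[symmetric] power2_eq_square)
  finally have eq: "(LINT s|unif. defect ?x (poly p (cis s))) =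
      2 * (LINT s|unif. norm (poly p (cis s)))
      - 2 * (sqrt (norm ?x) * (LINT s|unif. sqrt (norm (poly p (cis s)))))"
    by simp
  have "sqrt (norm ?x) * sqrt (norm ?x) \<le> sqrt (norm ?x) * (LINT s|unif. sqrt (norm (poly p (cis s))))"
    by (intro mult_left_mono mean_sqrt_poly_ge) auto
  hence "norm ?x \<le> sqrt (norm ?x) * (LINT s|unif. sqrt (norm (poly p (cis s))))"
    by simp
  thus ?thesis unfolding eq by simp
qed

lemma integrable_norm_pair_poly:
  "integrable (unif \<Otimes>\<^sub>M unif) (\<lambda>z. norm (poly p (cis (fst z)), y + (poly p (cis (snd z)) - x)))"
proof -
  interpret pair_prob_space unif unif ..
  obtain B where B: "\<And>s. norm (poly p (cis s)) \<le> B" using bounded_poly_cis by blast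
  have [measurable]: "(\<lambda>s. poly p (cis s)) \<in> borel_measurable unif"
    using integrable_poly_cis by (rule borel_measurable_integrable)
  show ?thesis
  proof (rule integrable_const_bound[where B = "B + (norm y + (B + norm x))"])
    show "AE z in unif \<Otimes>\<^sub>M unif. norm (norm (poly p (cis (fst z)), y + (poly p (cis (snd z)) - x)))
        \<le> B + (norm y + (B + norm x))"
    proof (rule AE_I2)
      fix z :: "real \<times> real"
      have "norm (poly p (cis (fst z)), y + (poly p (cis (snd z)) - x))
          \<le> norm (poly p (cis (fst z))) + norm (y + (poly p (cis (snd z)) - x))"
        by (rule norm_Pair_le)
      also have "norm (y + (poly p (cis (snd z)) - x)) \<le> norm y + (norm (poly p (cis (snd z))) + norm x)"
        using norm_triangle_ineq norm_triangle_ineq4 by (smt (verit))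
      finally show "norm (norm (poly p (cis (fst z)), y + (poly p (cis (snd z)) - x)))
          \<le> B + (norm y + (B + norm x))"
        using B[of "fst z"] B[of "snd z"] by simp
    qed
  qed measurable
qed

lemma integrable_norm_pair_poly_inner:
  "integrable unif (\<lambda>s'. norm (z, y + (poly p (cis s') - x)))"
proof -
  obtain B where B: "\<And>s. norm (poly p (cis s)) \<le> B" using bounded_poly_cis by blast
  show ?thesis
  proof (intro integrable_unif_continuous[where B = "norm z + (norm y + (B + norm x))"])
    fix s'
    have "norm (y + (poly p (cis s') - x)) \<le> norm y + (norm (poly p (cis s')) + norm x)"
      using norm_triangle_ineq norm_triangle_ineq4 by (smt (verit))
    thus "norm (norm (z, y + (poly p (cis s') - x))) \<le> norm z + (norm y + (B + norm x))"
      using norm_Pair_le[of z "y + (poly p (cis s') - x)"] B[of s'] by simp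
  qed (intro continuous_intros)
qed

lemma integrable_norm_pair_poly_outer:
  "integrable unif (\<lambda>s. LINT s'|unif. norm (poly p (cis s), y + (poly p (cis s') - x)))"
proof -
  interpret pair_prob_space unif unif ..
  show ?thesis using integrable_fst'[OF integrable_norm_pair_poly[of p y x]] by simp
qed

text \<open>The first-order terms average to zero, since f(s) and f(s') both have mean x. There
  remain 27 times two means of the defect, each at most 2 (E|f| - |x|), hence 108 = 27 * 2 *
  2.\<close>

lemma mean_norm_pair_poly_le:
  fixes p :: "complex poly" and y :: complex
  defines "x \<equiv> poly p 0"
  shows "(LINT s|unif. LINT s'|unif. norm (poly p (cis s), y + (poly p (cis s') - x)))
           \<le> norm (x, y) + 108 * ((LINT s|unif. norm (poly p (cis s))) - norm x)"
proof -
  define f where "f s = poly p (cis s)" for s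
  note I = integrable_poly_cis[of p, folded f_def]
  note outer = integrable_norm_pair_poly_outer[of p y x, folded f_def]
  note inner = integrable_norm_pair_poly_inner[of _ y p x, folded f_def]
  have "(LINT s|unif. LINT s'|unif. norm (f s, y + (f s' - x)))
      \<le> norm (x, y) + 108 * ((LINT s|unif. norm (f s)) - norm x)"
  proof (cases "x = 0")
    \<comment> \<open>At x = 0 there is no point to expand around, but the gap E|f| - |x| is then
      all of E|f|, and the triangle inequality gives even the constant 2.\<close>
    case True
    have "(LINT s'|unif. norm (f s, y + (f s' - x))) \<le> (LINT s'|unif. norm (f s) + (norm y + norm (f s')))" for s
      using inner[of "f s"] I True
      by (intro integral_mono)
        (auto intro!: order.trans[OF norm_Pair_le] add_mono norm_triangle_ineq)
    hence "(LINT s|unif. LINT s'|unif. norm (f s, y + (f s' - x)))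
        \<le> (LINT s|unif. LINT s'|unif. norm (f s) + (norm y + norm (f s')))"
      using I by (intro integral_mono[OF outer]) (auto simp: unif.prob_space)
    also have "\<dots> = (LINT s|unif. norm (f s)) + (norm y + (LINT s|unif. norm (f s)))"
      using I by (simp add: unif.prob_space)
    also have "\<dots> \<le> norm y + 108 * (LINT s|unif. norm (f s))"
    proof -
      have "u + (v + u) \<le> v + 108 * u" if "u \<ge> 0" for u v :: real using that by simp
      thus ?thesis by simp
    qed
    finally show ?thesis using True by (simp add: norm_Pair)
  next
    case False
    define r where "r = norm (x, y)"
    define E where "E = (LINT s|unif. defect x (f s))"
    have D: "integrable unif (\<lambda>s. defect x (f s))"
      unfolding f_def by (rule integrable_defect_poly)
    have mean: "(LINT s|unif. f s) = x"
      using integral_poly_cis[of p] by (simp add: f_def x_def)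
    have "(LINT s'|unif. norm (f s, y + (f s' - x)))
        \<le> (LINT s'|unif. r + (inner x (f s - x) + inner y (f s' - x)) / r
              + 27 * (defect x (f s) + defect x (f s')))" for s
    proof (rule integral_mono[OF inner])
      fix s'
      show "norm (f s, y + (f s' - x)) \<le> r + (inner x (f s - x) + inner y (f s' - x)) / r
          + 27 * (defect x (f s) + defect x (f s'))"
        using norm_pair_add_le[OF False, of "f s - x" y "f s' - x"] by (simp add: r_def)
    qed (use I D in auto)
    also have "\<dots> s = r + (inner x (f s - x) + inner y (x - x)) / r + 27 * (defect x (f s) + E)" for s
      using I D unfolding mean[symmetric] E_def by (simp add: unif.prob_space inner_diff_right)
    finally have "(LINT s|unif. LINT s'|unif. norm (f s, y + (f s' - x)))
        \<le> (LINT s|unif. r + (inner x (f s - x) + inner y (x - x)) / r + 27 * (defect x (f s) + E))"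
      using I D by (intro integral_mono[OF outer]) auto
    also have "\<dots> = r + (inner x (x - x) + inner y (x - x)) / r + 27 * (E + E)"
      using I D mean unfolding E_def by (simp add: unif.prob_space inner_diff_right)
    also have "\<dots> = r + 54 * E" by simp
    also have "E \<le> 2 * ((LINT s|unif. norm (f s)) - norm x)"
      using integral_defect_poly_le[of p] False unfolding x_def f_def E_def by simp
    finally show ?thesis unfolding r_def by simp
  qed
  thus ?thesis unfolding f_def .
qed

section \<open>Characters and the projection onto single variables\<close>

lemma character_eq_cis_sum:
  assumes "finite B" "supp n \<subseteq> B"
  shows "character n t = cis (\<Sum>j\<in>B. real_of_int (n j) * t j)"
proof -
  have "(\<Sum>j\<in>B. real_of_int (n j) * t j) = (\<Sum>j\<in>supp n. real_of_int (n j) * t j)"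
    using assms by (intro sum.mono_neutral_right) (auto simp: supp_def)
  thus ?thesis by (simp add: character_def)
qed

lemma norm_character [simp]: "norm (character n t) = 1"
  by (simp add: character_def)

lemma character_zero [simp]: "character (\<lambda>_. 0) t = 1"
  by (simp add: character_def supp_def)

lemma supp_zero [simp]: "supp (\<lambda>_. 0) = {}"
  by (simp add: supp_def)

lemma supp_upd_zero [simp]: "supp (n(i := 0)) = supp n - {i}"
  by (auto simp: supp_def)

lemma cnj_character: "cnj (character n t) = character (\<lambda>j. - n j) t"
  by (simp add: character_def supp_def cis_cnj sum_negf)

lemma character_mult:
  assumes "finite (supp n)" "finite (supp m)"
  shows "character n t * character m t = character (\<lambda>j. n j + m j) t"
proof -
  have "supp (\<lambda>j. n j + m j) \<subseteq> supp n \<union> supp m" by (auto simp: supp_def)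
  thus ?thesis
    using assms
    by (subst (1 2 3) character_eq_cis_sum[of "supp n \<union> supp m"])
      (auto simp: cis_mult sum.distrib algebra_simps)
qed

lemma character_upd:
  assumes "finite (supp n)"
  shows "character n (t(i := s)) = cis (real_of_int (n i) * s) * character (n(i := 0)) t"
proof -
  let ?B = "insert i (supp n)"
  have "(\<Sum>j\<in>?B. real_of_int (n j) * (t(i := s)) j) = real_of_int (n i) * s + (\<Sum>j\<in>?B. real_of_int ((n(i := 0)) j) * t j)"
    using assms by (simp add: sum.remove[of ?B i] sum.insert_remove)
  thus ?thesis
    using assms by (subst (1 2) character_eq_cis_sum[of ?B]) (auto simp: cis_mult)
qed

lemma character_cong:
  assumes "\<And>j. j \<in> supp n \<Longrightarrow> t j = u j"
  shows "character n t = character n u"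
  unfolding character_def using assms by (intro arg_cong[of _ _ cis] sum.cong) auto

lemma mindexD: "n \<in> mindex I \<Longrightarrow> finite (supp n)" "n \<in> mindex I \<Longrightarrow> supp n \<subseteq> I"
  by (auto simp: mindex_def)

lemma amindex_imp_mindex: "n \<in> amindex I \<Longrightarrow> n \<in> mindex I"
  by (simp add: amindex_def)

section \<open>Integration on the torus\<close>

lemma measurable_cis [measurable]: "cis \<in> borel_measurable borel"
  by (intro borel_measurable_continuous_onI continuous_intros)

lemma measurable_torus_component [measurable (raw)]:
  "j \<in> J \<Longrightarrow> (\<lambda>t. t j) \<in> borel_measurable (torus J)"
  using measurable_component_singleton[of j J "\<lambda>_. unif"]
  by (auto simp: torus_def cong: measurable_cong_sets)

lemma measurable_character [measurable (raw)]:
  assumes "n \<in> mindex I"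
  shows "character n \<in> borel_measurable (torus I)"
  unfolding character_def by measurable (use mindexD(2)[OF assms] in auto)

lemma prob_space_torus: "prob_space (torus I)"
  unfolding torus_def by (intro prob_space_PiM prob_space_unif)

interpretation torus: prob_space "torus I" for I
  by (rule prob_space_torus)

lemma space_torus: "space (torus I) = extensional I"
  by (auto simp: torus_def space_PiM PiE_def)

lemma integrable_torus_bounded:
  fixes f :: "(nat \<Rightarrow> real) \<Rightarrow> 'a::{banach, second_countable_topology}"
  assumes "f \<in> borel_measurable (torus I)" "\<And>t. norm (f t) \<le> B"
  shows "integrable (torus I) f"
  using assms by (intro torus.integrable_const_bound[where B = B]) auto

lemma measurable_torus_upd [measurable]:
  "(\<lambda>(s, t). t(i := s)) \<in> measurable (unif \<Otimes>\<^sub>M torus J) (torus (insert i J))"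
proof -
  have "(\<lambda>(t, s). t(i := s)) \<in> measurable (torus J \<Otimes>\<^sub>M unif) (torus (insert i J))"
    unfolding torus_def by (rule measurable_add_dim)
  from measurable_compose[OF measurable_pair_swap' this] show ?thesis
    by (simp add: case_prod_beta')
qed

text \<open>The split-off coordinate is integrated outermost, since the induction on the number of
  variables estimates slices at a fixed value s.\<close>

lemma integral_torus_insert:
  fixes f :: "(nat \<Rightarrow> real) \<Rightarrow> 'a::{banach, second_countable_topology}"
  assumes J: "finite J" "i \<notin> J" and f [measurable]: "f \<in> borel_measurable (torus (insert i J))"
    and B: "\<And>t. norm (f t) \<le> B"
  shows "(LINT t|torus (insert i J). f t) = (LINT s|unif. LINT t|torus J. f (t(i := s)))"
proof -
  interpret product_sigma_finite "\<lambda>_::nat. unif" ..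
  interpret pair_prob_space unif "torus J" ..
  have "(LINT t|torus (insert i J). f t) = (LINT t|torus J. LINT s|unif. f (t(i := s)))"
    unfolding torus_def using J integrable_torus_bounded[OF f B]
    by (intro product_integral_insert) (auto simp: torus_def)
  also have "\<dots> = (LINT s|unif. LINT t|torus J. f (t(i := s)))"
  proof (rule Fubini_integral)
    have "(\<lambda>z. f ((\<lambda>(s, t). t(i := s)) z)) \<in> borel_measurable (unif \<Otimes>\<^sub>M torus J)"
      by measurable
    thus "integrable (unif \<Otimes>\<^sub>M torus J) (\<lambda>(s, t). f (t(i := s)))"
      using B by (intro integrable_const_bound[where B = B]) (auto simp: case_prod_beta')
  qed
  finally show ?thesis .
qed

text \<open>Frequencies form an indexed family with repetitions allowed: deleting a coordinate can
  make two frequencies equal, and a difference of two polynomials is indexed by a disjoint union.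
  Neither operation then requires merging coefficients.\<close>

definition trigsum :: "'k set \<Rightarrow> ('k \<Rightarrow> complex) \<Rightarrow> ('k \<Rightarrow> nat \<Rightarrow> int) \<Rightarrow> (nat \<Rightarrow> real) \<Rightarrow> complex" where
  "trigsum F c p t = (\<Sum>k\<in>F. c k * character (p k) t)"

lemma norm_trigsum_le: "norm (trigsum F c p t) \<le> (\<Sum>k\<in>F. norm (c k))"
  unfolding trigsum_def by (intro sum_norm_le) (simp add: norm_mult)

lemma measurable_trigsum:
  assumes "\<And>k. k \<in> F \<Longrightarrow> p k \<in> mindex I"
  shows "trigsum F c p \<in> borel_measurable (torus I)"
  unfolding trigsum_def using assms by measurable

lemma integrable_trigsum:
  assumes "\<And>k. k \<in> F \<Longrightarrow> p k \<in> mindex I"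
  shows "integrable (torus I) (trigsum F c p)"
  by (rule integrable_torus_bounded[OF measurable_trigsum norm_trigsum_le]) (rule assms)

lemma integrable_Pair:
  fixes f :: "'a \<Rightarrow> 'b::{banach, second_countable_topology}"
    and g :: "'a \<Rightarrow> 'c::{banach, second_countable_topology}"
  assumes "integrable M f" "integrable M g"
  shows "integrable M (\<lambda>x. (f x, g x))"
proof -
  have "bounded_linear (\<lambda>x::'b. (x, 0::'c))" "bounded_linear (\<lambda>x::'c. (0::'b, x))"
    by (intro bounded_linear_Pair bounded_linear_ident bounded_linear_zero)+
  hence "integrable M (\<lambda>x. (f x, 0::'c))" "integrable M (\<lambda>x. (0::'b, g x))"
    using assms by (auto intro: integrable_bounded_linear)
  from Bochner_Integration.integrable_add[OF this] show ?thesis by simp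
qed

lemma character_empty_supp: "supp n = {} \<Longrightarrow> character n t = 1"
  by (simp add: character_def)

text \<open>In the step that adds variable i, \<open>q\<close> is the mean over the other variables,
  as a function of variable i, and \<open>G s\<close> is P_1 in the other variables of the slice at
  s. The one-variable estimate handles \<open>q\<close>, the induction hypothesis the slices, and
  the two errors telescope.\<close>

lemma integral_P1_pair_le:
  fixes F :: "'k set"
  assumes "finite J" "finite F" "\<And>k. k \<in> F \<Longrightarrow> p k \<in> amindex J"
  defines "a \<equiv> (\<lambda>c. \<Sum>k | k \<in> F \<and> supp (p k) = {}. c k)"
  shows "(LINT t|torus J. norm (a c, y + trigsum {k \<in> F. card (supp (p k)) = 1} c p t))
           \<le> norm (a c, y) + 108 * ((LINT t|torus J. norm (trigsum F c p t)) - norm (a c))"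
  using assms(1,3) unfolding a_def
proof (induction J arbitrary: c p y)
  case empty
  hence supp: "supp (p k) = {}" if "k \<in> F" for k
    using that by (auto simp: amindex_def mindex_def)
  hence "trigsum F c p t = (\<Sum>k\<in>F. c k)" for t
    unfolding trigsum_def by (intro sum.cong) (auto simp: character_empty_supp)
  moreover have "{k \<in> F. card (supp (p k)) = 1} = {}" "{k \<in> F. supp (p k) = {}} = F"
    using supp by auto
  ultimately show ?case
    by (simp only:) (simp add: torus.prob_space trigsum_def)
next
  case (insert i J)
  let ?T = "torus (insert i J)"
  have fin: "finite (supp (p k))" and nn: "p k j \<ge> 0" and pm: "p k \<in> mindex (insert i J)" if "k \<in> F" for k j
    using insert.prems[OF that] by (auto simp: amindex_def mindex_def)
  define p' where "p' k = (p k)(i := 0)" for k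
  have p': "p' k \<in> amindex J" if "k \<in> F" for k
    using insert.prems[OF that] by (auto simp: amindex_def mindex_def p'_def)
  define c' where "c' s k = c k * cis (real_of_int (p k i) * s)" for s k
  define F0 where "F0 = {k \<in> F. supp (p' k) = {}}"
  define F1 where "F1 = {k \<in> F. card (supp (p' k)) = 1}"
  \<comment> \<open>Nonnegative exponents make this a genuine polynomial in cis (t i), as the
    one-variable estimate demands; its value at 0 is x.\<close>
  define q where "q = (\<Sum>k\<in>F0. monom (c k) (nat (p k i)))"
  define x where "x = (\<Sum>k | k \<in> F \<and> supp (p k) = {}. c k)"
  define R where "R t = trigsum {k \<in> F1. p k i = 0} c p' t" for t
  define G where "G s t = trigsum F1 (c' s) p' t" for s t
  define B where "B = (\<Sum>k\<in>F. norm (c k))"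
  have FF: "F0 \<subseteq> F" "F1 \<subseteq> F" "finite F0" "finite F1"
    using \<open>finite F\<close> by (auto simp: F0_def F1_def)
  have upd: "trigsum F c p (t(i := s)) = trigsum F (c' s) p' t" for s t
    unfolding trigsum_def by (intro sum.cong) (auto simp: character_upd[OF fin] c'_def p'_def mult_ac)
  have q: "poly q (cis s) = (\<Sum>k\<in>F0. c' s k)" for s
    unfolding q_def poly_sum c'_def poly_monom
    using FF nn by (intro sum.cong) (auto simp: Complex.DeMoivre)
  have q0: "poly q 0 = x"
  proof -
    have "poly q 0 = (\<Sum>k\<in>F0. if supp (p k) = {} then c k else 0)"
      unfolding q_def poly_sum poly_monom
    proof (intro sum.cong refl)
      fix k assume k: "k \<in> F0"
      have "supp (p k) = {} \<longleftrightarrow> p k i = 0"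
        using k by (force simp: F0_def p'_def supp_def split: if_splits)
      thus "c k * 0 ^ nat (p k i) = (if supp (p k) = {} then c k else 0)"
        using nn[of k i] k FF by (auto simp: power_0_left)
    qed
    also have "\<dots> = x"
      unfolding x_def using FF by (subst sum.inter_filter[symmetric]) (auto simp: F0_def p'_def intro!: sum.cong)
    finally show ?thesis .
  qed
  have P1: "trigsum {k \<in> F. card (supp (p k)) = 1} c p t = (poly q (cis (t i)) - x) + R t" for t
  proof -
    have char: "character (p k) t = cis (real_of_int (p k i) * t i) * character (p' k) t" if "k \<in> F" for k
      using character_upd[OF fin[OF that], of t i "t i"] by (simp add: p'_def)
    have eq: "{k \<in> F. card (supp (p k)) = 1} = {k \<in> F0. supp (p k) \<noteq> {}} \<union> {k \<in> F1. p k i = 0}"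
    proof (intro set_eqI iffI)
      fix k assume k: "k \<in> {k \<in> F. card (supp (p k)) = 1}"
      then obtain j where "supp (p k) = {j}" by (auto simp: card_1_singleton_iff)
      thus "k \<in> {k \<in> F0. supp (p k) \<noteq> {}} \<union> {k \<in> F1. p k i = 0}"
        using k by (cases "j = i") (auto simp: F0_def F1_def p'_def, auto simp: supp_def)
    next
      fix k assume k: "k \<in> {k \<in> F0. supp (p k) \<noteq> {}} \<union> {k \<in> F1. p k i = 0}"
      thus "k \<in> {k \<in> F. card (supp (p k)) = 1}"
      proof
        assume k: "k \<in> {k \<in> F0. supp (p k) \<noteq> {}}"
        hence "supp (p k) = {i}" by (auto simp: F0_def p'_def)
        thus ?thesis using k FF by auto
      next
        assume k: "k \<in> {k \<in> F1. p k i = 0}"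
        hence "supp (p' k) = supp (p k)" by (auto simp: p'_def supp_def)
        thus ?thesis using k by (auto simp: F1_def)
      qed
    qed
    have "poly q (cis (t i)) - x = (\<Sum>k | k \<in> F0 \<and> supp (p k) \<noteq> {}. c k * character (p k) t)"
    proof -
      have "poly q (cis (t i)) = (\<Sum>k\<in>F0. c k * character (p k) t)"
        unfolding q c'_def using FF char
        by (intro sum.cong) (auto simp: F0_def character_empty_supp)
      also have "\<dots> = (\<Sum>k\<in>{k \<in> F0. supp (p k) = {}} \<union> {k \<in> F0. supp (p k) \<noteq> {}}. c k * character (p k) t)"
        by (intro sum.cong) auto
      also have "\<dots> = (\<Sum>k | k \<in> F0 \<and> supp (p k) = {}. c k * character (p k) t)
          + (\<Sum>k | k \<in> F0 \<and> supp (p k) \<noteq> {}. c k * character (p k) t)"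
        using FF by (intro sum.union_disjoint) auto
      also have "(\<Sum>k | k \<in> F0 \<and> supp (p k) = {}. c k * character (p k) t) = x"
        unfolding x_def by (intro sum.cong) (auto simp: F0_def p'_def character_empty_supp)
      finally show ?thesis by simp
    qed
    moreover have "R t = (\<Sum>k | k \<in> F1 \<and> p k i = 0. c k * character (p k) t)"
      unfolding R_def trigsum_def using FF char by (intro sum.cong) auto
    moreover have "{k \<in> F0. supp (p k) \<noteq> {}} \<inter> {k \<in> F1. p k i = 0} = {}"
      by (auto simp: F0_def F1_def)
    ultimately show ?thesis
      unfolding trigsum_def eq using FF by (subst sum.union_disjoint) auto
  qed
  \<comment> \<open>Averaging over s removes the frequencies that involve i, so the mean of
    \<open>G s\<close> is the part \<open>R\<close> of P_1 that avoids i.\<close>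
  have Gs: "integrable unif (\<lambda>s. G s t)" and intG: "(LINT s|unif. G s t) = R t" for t
  proof -
    have i: "integrable unif (\<lambda>s. c k * cis (real_of_int (p k i) * s) * character (p' k) t)" for k
      by (intro integrable_unif_continuous[where B = "norm (c k)"] continuous_intros) (auto simp: norm_mult)
    show "integrable unif (\<lambda>s. G s t)"
      unfolding G_def trigsum_def c'_def by (intro Bochner_Integration.integrable_sum i)
    have "(LINT s|unif. G s t) = (\<Sum>k\<in>F1. c k * (LINT s|unif. cis (real_of_int (p k i) * s)) * character (p' k) t)"
      unfolding G_def trigsum_def c'_def by (subst Bochner_Integration.integral_sum[OF i]) simp
    also have "\<dots> = R t"
      unfolding R_def trigsum_def integral_unif_cis using FF
      by (subst sum.inter_filter) (auto intro!: sum.cong)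
    finally show "(LINT s|unif. G s t) = R t" .
  qed
  obtain C where C: "\<And>s. norm (poly q (cis s)) \<le> C" using bounded_poly_cis by blast
  have Gb: "norm (G s t) \<le> B" for s t
  proof -
    have "norm (G s t) \<le> (\<Sum>k\<in>F1. norm (c' s k))" unfolding G_def by (rule norm_trigsum_le)
    also have "\<dots> \<le> B" unfolding B_def c'_def using FF \<open>finite F\<close>
      by (intro order_trans[OF _ sum_mono2[of F F1]]) (auto simp: norm_mult)
    finally show ?thesis .
  qed
  \<comment> \<open>Variable i is decoupled: s enters the first slot and the slice, while t i
    carries only its own contribution to P_1. The mean over s of the vector inside the norm is
    exactly (x, y + P_1 f).\<close>
  define H where "H s t = norm (poly q (cis s), y + (poly q (cis (t i)) - x) + G s t)" for s t
  define D where "D = C + (norm y + (C + norm x) + B)"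
  have Hb: "norm (H s t) \<le> D" for s t
  proof -
    have "H s t \<le> norm (poly q (cis s)) + norm (y + (poly q (cis (t i)) - x) + G s t)"
      unfolding H_def by (rule norm_Pair_le)
    also have "norm (y + (poly q (cis (t i)) - x) + G s t) \<le> norm y + (norm (poly q (cis (t i))) + norm x) + norm (G s t)"
      using norm_triangle_ineq norm_triangle_ineq4 by (smt (verit))
    finally show ?thesis
      using C[of s] C[of "t i"] Gb[of s t] unfolding D_def by (simp add: H_def)
  qed
  have [measurable]: "character (p' k) \<in> borel_measurable ?T" if "k \<in> F1" for k
    using p'[of k] that FF by (intro measurable_character) (auto simp: amindex_def mindex_def)
  have [measurable]: "(\<lambda>t. t i) \<in> borel_measurable ?T"
    by (rule measurable_torus_component) simp
  have [measurable]: "poly q \<in> borel_measurable borel"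
    by (intro borel_measurable_continuous_onI continuous_intros)
  have Hm [measurable]: "(\<lambda>(s, t). H s t) \<in> borel_measurable (unif \<Otimes>\<^sub>M ?T)"
    unfolding H_def G_def trigsum_def c'_def by measurable
  interpret pair_prob_space unif ?T ..
  have Hi: "integrable (unif \<Otimes>\<^sub>M ?T) (\<lambda>(s, t). H s t)"
    using Hb by (intro integrable_const_bound[where B = D]) auto
  have jensen: "norm (x, y + trigsum {k \<in> F. card (supp (p k)) = 1} c p t) \<le> (LINT s|unif. H s t)" for t
  proof -
    let ?w = "\<lambda>s. (poly q (cis s), y + (poly q (cis (t i)) - x) + G s t)"
    have w: "integrable unif ?w"
      using integrable_poly_cis[of q] Gs[of t]
      by (intro integrable_Pair) auto
    have "(x, y + trigsum {k \<in> F. card (supp (p k)) = 1} c p t) = (LINT s|unif. ?w s)"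
      using Bochner_Integration.integral_fst[OF w] Bochner_Integration.integral_snd[OF w] integrable_poly_cis[of q] Gs[of t]
      unfolding P1 add.assoc[symmetric] by (intro prod_eqI) (auto simp: integral_poly_cis q0 intG unif.prob_space)
    thus ?thesis
      unfolding H_def using integral_norm_bound[of unif ?w] by (simp only:)
  qed
  have integrable_unif_H: "integrable unif (\<lambda>s. H s t)" for t
    unfolding H_def using integrable_poly_cis[of q] Gs[of t]
    by (intro integrable_norm integrable_Pair) auto
  define A where "A s = (LINT t|torus J. norm (trigsum F (c' s) p' t))" for s
  have fm [measurable]: "trigsum F c p \<in> borel_measurable ?T"
    using pm by (rule measurable_trigsum)
  have intA: "(LINT s|unif. A s) = (LINT t|?T. norm (trigsum F c p t))"
    unfolding A_def upd[symmetric] using norm_trigsum_le[of F c p]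
    by (intro integral_torus_insert[OF insert.hyps, symmetric, where B = B]) (auto simp: B_def)
  have Ai: "integrable unif A"
  proof -
    interpret J: pair_prob_space unif "torus J" ..
    have "integrable (unif \<Otimes>\<^sub>M torus J) (\<lambda>z. norm (trigsum F c p ((\<lambda>(s, t). t(i := s)) z)))"
      using norm_trigsum_le[of F c p]
      by (intro J.integrable_const_bound[where B = B]) (auto simp: B_def)
    from J.integrable_fst'[OF this] show ?thesis
      by (simp add: A_def[abs_def] upd)
  qed
  have split: "(LINT s'|unif. norm (z, y + (poly q (cis s') - x)) + b) =
      (LINT s'|unif. norm (z, y + (poly q (cis s') - x))) + b" for z b
    using integrable_norm_pair_poly_inner[of z y q x]
    by (subst Bochner_Integration.integral_add) (auto simp: unif.prob_space)
  have "(LINT t|?T. norm (x, y + trigsum {k \<in> F. card (supp (p k)) = 1} c p t)) \<le> (LINT t|?T. LINT s|unif. H s t)"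
  proof (rule integral_mono)
    have [measurable]: "trigsum {k \<in> F. card (supp (p k)) = 1} c p \<in> borel_measurable ?T"
      using pm by (intro measurable_trigsum) auto
    have "norm (norm (x, y + trigsum {k \<in> F. card (supp (p k)) = 1} c p t)) \<le> D" for t
    proof -
      have "(LINT s|unif. H s t) \<le> (LINT s|unif. D)"
        using Hb by (intro integral_mono integrable_unif_H) (auto simp: abs_le_iff)
      thus ?thesis using jensen[of t] by (simp add: unif.prob_space)
    qed
    thus "integrable ?T (\<lambda>t. norm (x, y + trigsum {k \<in> F. card (supp (p k)) = 1} c p t))"
      by (intro integrable_torus_bounded) (auto simp del: One_nat_def)
    show "integrable ?T (\<lambda>t. LINT s|unif. H s t)"
      using integrable_snd[OF Hi] .
  qed (rule jensen)
  also have "\<dots> = (LINT s|unif. LINT t|?T. H s t)"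
    using Hi by (rule Fubini_integral)
  also have "\<dots> = (LINT s|unif. LINT s'|unif. LINT t|torus J. H s (t(i := s')))"
    using Hb by (intro Bochner_Integration.integral_cong refl integral_torus_insert[OF insert.hyps]) auto
  also have "\<dots> \<le> (LINT s|unif. LINT s'|unif. norm (poly q (cis s), y + (poly q (cis s') - x)) +
      108 * (A s - norm (poly q (cis s))))"
  proof (rule integral_mono)
    have "(LINT s'|unif. LINT t|torus J. H s (t(i := s'))) = (LINT t|?T. H s t)" for s
      using Hb by (intro integral_torus_insert[OF insert.hyps, symmetric]) auto
    thus "integrable unif (\<lambda>s. LINT s'|unif. LINT t|torus J. H s (t(i := s')))"
      using integrable_fst[OF Hi] by simp
    show "integrable unif (\<lambda>s. LINT s'|unif. norm (poly q (cis s), y + (poly q (cis s') - x)) +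
      108 * (A s - norm (poly q (cis s))))"
      unfolding split using integrable_norm_pair_poly_outer[of q y x] Ai integrable_poly_cis[of q]
      by simp
    fix s
    show "(LINT s'|unif. LINT t|torus J. H s (t(i := s'))) \<le>
        (LINT s'|unif. norm (poly q (cis s), y + (poly q (cis s') - x)) + 108 * (A s - norm (poly q (cis s))))"
    proof (rule integral_mono)
      interpret J: pair_prob_space unif "torus J" ..
      have "integrable (unif \<Otimes>\<^sub>M torus J) (\<lambda>z. H s ((\<lambda>(s', t). t(i := s')) z))"
        using Hb by (intro J.integrable_const_bound[where B = D]) auto
      thus "integrable unif (\<lambda>s'. LINT t|torus J. H s (t(i := s')))"
        using J.integrable_fst' by fastforce
      show "integrable unif (\<lambda>s'. norm (poly q (cis s), y + (poly q (cis s') - x)) + 108 * (A s - norm (poly q (cis s))))"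
        using integrable_norm_pair_poly_inner[of "poly q (cis s)" y q x] by simp
      fix s'
      have "H s (t(i := s')) = norm (poly q (cis s), (y + (poly q (cis s') - x)) + trigsum F1 (c' s) p' t)" for t
      proof -
        have "character (p' k) (t(i := s')) = character (p' k) t" for k
          by (intro character_cong) (auto simp: p'_def)
        thus ?thesis by (simp add: H_def G_def trigsum_def)
      qed
      \<comment> \<open>For fixed s and s' the slice has coefficients \<open>c' s\<close> and
        constant term q(cis s); the arbitrary second entry is used with the shift q(cis s') -
        x.\<close>
      thus "(LINT t|torus J. H s (t(i := s'))) \<le> norm (poly q (cis s), y + (poly q (cis s') - x)) + 108 * (A s - norm (poly q (cis s)))"
        using insert.IH[OF p', of "\<lambda>k. k" "c' s" "y + (poly q (cis s') - x)"]
        unfolding A_def q F0_def F1_def by simp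
    qed
  qed
  also have "\<dots> = (LINT s|unif. LINT s'|unif. norm (poly q (cis s), y + (poly q (cis s') - x))) +
      108 * ((LINT s|unif. A s) - (LINT s|unif. norm (poly q (cis s))))"
    unfolding split using integrable_norm_pair_poly_outer[of q y x] Ai integrable_poly_cis[of q]
    by simp
  \<comment> \<open>The one-variable estimate contributes 108 (E|q| - |x|), and its E|q| cancels the
    one subtracted in the preceding expression. Equality of the two constants is essential
    here.\<close>
  also have "\<dots> \<le> norm (x, y) + 108 * ((LINT t|?T. norm (trigsum F c p t)) - norm x)"
    using mean_norm_pair_poly_le[of q y] unfolding q0 intA by simp
  finally show ?case unfolding x_def .
qed

section \<open>Uniqueness of Fourier coefficients\<close>

lemma cis_inj_0_2pi:
  assumes "cis s = cis u" "s \<in> {0..<2*pi}" "u \<in> {0..<2*pi}"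
  shows "s = u"
proof -
  have "sin s = sin u \<and> cos s = cos u" using assms(1) by (simp add: complex_eq_iff)
  then obtain n :: int where n: "s = u + 2 * pi * n" using sin_cos_eq_iff[of s u] by auto
  have "\<bar>2 * pi * real_of_int n\<bar> < 2 * pi * 1" using n assms(2,3) by (simp only: atLeastLessThan_iff) linarith
  hence "\<bar>real_of_int n\<bar> < 1" unfolding abs_mult by (simp add: mult_less_cancel_left_pos)
  thus ?thesis using n by simp
qed

lemma integrable_mult_bounded:
  fixes G h :: "'a \<Rightarrow> complex"
  assumes "integrable M G" "h \<in> borel_measurable M" "\<And>x. norm (h x) \<le> B"
  shows "integrable M (\<lambda>x. G x * h x)"
proof (rule Bochner_Integration.integrable_bound)
  show "integrable M (\<lambda>x. B * norm (G x))" using assms by simp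
  show "(\<lambda>x. G x * h x) \<in> borel_measurable M" using assms by auto
  have "norm (G x * h x) \<le> norm (B * norm (G x))" for x
  proof -
    have "norm (G x) * norm (h x) \<le> norm (G x) * B" using assms(3) by (intro mult_left_mono) auto
    thus ?thesis by (simp add: norm_mult abs_mult mult.commute order_trans[OF _ mult_right_mono[OF abs_ge_self]])
  qed
  thus "AE x in M. norm (G x * h x) \<le> norm (B * norm (G x))" by simp
qed

lemma integrable_mult_cis:
  assumes "integrable M G" "T \<in> borel_measurable M"
  shows "integrable M (\<lambda>x. G x * cis (r * T x))"
  using assms by (intro integrable_mult_bounded[where B = 1]) auto

text \<open>Real polynomials in the real and imaginary part of a point on the circle are trigonometric
  polynomials, so multiplying by them preserves vanishing of all Fourier coefficients.\<close>
lemma fourier_zero_mult_polynomial: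
  fixes q :: "complex \<Rightarrow> real"
  assumes "real_polynomial_function q" and T: "T \<in> borel_measurable M"
  assumes "integrable M G" "\<And>k::int. (LINT x|M. G x * cis (real_of_int k * T x)) = 0"
  shows "integrable M (\<lambda>x. G x * of_real (q (cis (T x))))
    \<and> (\<forall>k::int. (LINT x|M. G x * of_real (q (cis (T x))) * cis (real_of_int k * T x)) = 0)"
  using assms(1,3,4)
proof (induction arbitrary: G)
  case (linear f)
  interpret bounded_linear f by fact
  \<comment> \<open>Euler's formula for f 1 * cos \<theta> + f \<i> * sin \<theta>: multiplication
    by a real-linear function shifts frequencies by 1 and -1.\<close>
  define \<alpha> where "\<alpha> = (of_real (f 1) - \<i> * of_real (f \<i>)) / 2"
  define \<beta> where "\<beta> = (of_real (f 1) + \<i> * of_real (f \<i>)) / 2"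
  have f: "complex_of_real (f (cis \<theta>)) = \<alpha> * cis \<theta> + \<beta> * cis (-\<theta>)" for \<theta>
  proof -
    have "cis \<theta> = cos \<theta> *\<^sub>R 1 + sin \<theta> *\<^sub>R \<i>" by (simp add: complex_eq_iff)
    hence "f (cis \<theta>) = f (cos \<theta> *\<^sub>R 1 + sin \<theta> *\<^sub>R \<i>)" by (rule arg_cong)
    also have "\<dots> = cos \<theta> * f 1 + sin \<theta> * f \<i>" unfolding add scaleR by simp
    finally show ?thesis unfolding \<alpha>_def \<beta>_def by (simp add: complex_eq_iff field_simps)
  qed
  have eq: "G x * of_real (f (cis (T x))) * cis (r * T x)
      = \<alpha> * (G x * cis ((r + 1) * T x)) + \<beta> * (G x * cis ((r - 1) * T x))" for x r
  proof -
    have "cis ((r + 1) * T x) = cis (T x) * cis (r * T x)" "cis ((r - 1) * T x) = cis (- T x) * cis (r * T x)"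
      by (simp_all add: cis_mult algebra_simps)
    thus ?thesis unfolding f by (simp only: algebra_simps)
  qed
  have I: "integrable M (\<lambda>x. G x * cis (r * T x))" for r
    using linear.prems(1) T by (rule integrable_mult_cis)
  have "integrable M (\<lambda>x. G x * of_real (f (cis (T x))) * cis (0 * T x))"
    unfolding eq by (intro Bochner_Integration.integrable_add integrable_mult_right I)
  moreover have "(LINT x|M. G x * of_real (f (cis (T x))) * cis (real_of_int k * T x)) = 0" for k
    unfolding eq using I linear.prems(2)[of "k + 1"] linear.prems(2)[of "k - 1"] by simp
  ultimately show ?case by simp
next
  case (const c)
  have "(LINT x|M. G x * of_real c * cis (real_of_int k * T x)) = 0" for k
    using const(2)[of k] by (simp add: mult.assoc mult.left_commute[of _ "of_real c"])
  thus ?case using const(1) by simp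
next
  case (add f g)
  note f = add.IH(1)[OF add.prems] and g = add.IH(2)[OF add.prems]
  have I: "integrable M (\<lambda>x. G x * of_real (f (cis (T x))) * cis (r * T x))"
      "integrable M (\<lambda>x. G x * of_real (g (cis (T x))) * cis (r * T x))" for r
    using f g T by (auto intro: integrable_mult_cis)
  show ?case
    using f g I by (simp add: distrib_left distrib_right)
next
  case (mult f g)
  show ?case
    \<comment> \<open>The second factor is treated with the product of \<open>G\<close> and the
      first factor in the role of \<open>G\<close>, which is why \<open>G\<close> varies in the
      induction.\<close>
    using mult.IH(1)[OF mult.prems] mult.IH(2)[of "\<lambda>x. G x * of_real (f (cis (T x)))"]
    by (simp add: mult.assoc)
qed

text \<open>Stone-Weierstrass on the circle: a polynomial within e of \<phi> changes the integral by
  at most e times the L^1 norm of \<open>G\<close>, and with the polynomial it vanishes.\<close>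

lemma fourier_zero_mult_continuous:
  fixes \<phi> :: "complex \<Rightarrow> real"
  assumes \<phi>: "continuous_on UNIV \<phi>" and T [measurable]: "T \<in> borel_measurable M"
  assumes G: "integrable M G" "\<And>k::int. (LINT x|M. G x * cis (real_of_int k * T x)) = 0"
  shows "(LINT x|M. G x * of_real (\<phi> (cis (T x)))) = 0"
proof -
  have [measurable]: "\<phi> \<in> borel_measurable borel" by (intro borel_measurable_continuous_onI \<phi>)
  obtain B where B: "\<And>z. z \<in> sphere 0 1 \<Longrightarrow> norm (\<phi> z) \<le> B"
  proof -
    have "compact (\<phi> ` sphere 0 1)"
      by (intro compact_continuous_image compact_sphere continuous_on_subset[OF \<phi>]) auto
    hence "bounded (\<phi> ` sphere 0 1)" by (rule compact_imp_bounded)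
    then obtain B where "\<forall>z\<in>sphere 0 1. norm (\<phi> z) \<le> B" by (auto simp: bounded_iff)
    thus ?thesis by (intro that[of B]) blast
  qed
  have I: "integrable M (\<lambda>x. G x * of_real (\<phi> (cis (T x))))"
    using G(1) B by (intro integrable_mult_bounded[where B = B]) auto
  have bound: "norm (LINT x|M. G x * of_real (\<phi> (cis (T x)))) \<le> e * (LINT x|M. norm (G x))" if e: "e > 0" for e
  proof -
    obtain q where q: "real_polynomial_function q" "\<And>z. z \<in> sphere 0 1 \<Longrightarrow> \<bar>\<phi> z - q z\<bar> < e"
    proof (rule Stone_Weierstrass_real_polynomial_function)
      show "continuous_on (sphere 0 1) \<phi>" by (rule continuous_on_subset[OF \<phi>]) simp
    qed (use e in auto)
    note * = fourier_zero_mult_polynomial[OF q(1) T G]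
    have "(LINT x|M. G x * of_real (q (cis (T x)))) = 0"
      using *[THEN conjunct2, rule_format, of 0] by simp
    hence "(LINT x|M. G x * of_real (\<phi> (cis (T x)))) = (LINT x|M. G x * of_real (\<phi> (cis (T x))) - G x * of_real (q (cis (T x))))"
      using I * by (subst Bochner_Integration.integral_diff) auto
    also have "norm \<dots> \<le> (LINT x|M. e * norm (G x))"
    proof (rule order_trans[OF integral_norm_bound integral_mono])
      fix x
      have "norm (G x * of_real (\<phi> (cis (T x))) - G x * of_real (q (cis (T x))))
          = norm (G x) * \<bar>\<phi> (cis (T x)) - q (cis (T x))\<bar>"
        by (simp add: norm_mult flip: right_diff_distrib of_real_diff)
      also have "\<dots> \<le> norm (G x) * e"
        using q(2)[of "cis (T x)"] by (intro mult_left_mono) auto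
      finally show "norm (G x * of_real (\<phi> (cis (T x))) - G x * of_real (q (cis (T x)))) \<le> e * norm (G x)"
        by (simp add: mult.commute)
    qed (use I * G in auto)
    finally show ?thesis by simp
  qed
  have "norm (LINT x|M. G x * of_real (\<phi> (cis (T x)))) \<le> 0 + e" if "e > 0" for e
  proof -
    define S where "S = (LINT x|M. norm (G x))"
    have S: "S \<ge> 0" unfolding S_def by simp
    \<comment> \<open>Dividing by S + 1 instead of S covers the case S = 0.\<close>
    have "norm (LINT x|M. G x * of_real (\<phi> (cis (T x)))) \<le> e / (S + 1) * S"
      unfolding S_def by (rule bound) (use that S in \<open>simp add: S_def[symmetric]\<close>)
    also have "\<dots> \<le> e" using S that by (simp add: field_simps)
    finally show ?thesis by simp
  qed
  hence "norm (LINT x|M. G x * of_real (\<phi> (cis (T x)))) \<le> 0"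
    by (rule field_le_epsilon)
  thus ?thesis by simp
qed

text \<open>The tents \<open>\<phi> m\<close> decrease to the indicator because C is closed, and
  norm (G x) dominates. For empty C the tents would be constantly 1, as \<open>infdist\<close> to
  the empty set is 0.\<close>

lemma fourier_zero_indicator_closed:
  fixes C :: "complex set"
  assumes C: "closed C" "C \<noteq> {}" and T [measurable]: "T \<in> borel_measurable M"
  assumes G: "integrable M G" "\<And>k::int. (LINT x|M. G x * cis (real_of_int k * T x)) = 0"
  shows "(LINT x|M. G x * of_real (indicator C (cis (T x)))) = 0"
proof -
  define \<phi> where "\<phi> m z = max 0 (1 - real m * infdist z C)" for m z
  have cont: "continuous_on UNIV (\<phi> m)" for m
    unfolding \<phi>_def by (intro continuous_intros)
  have [measurable]: "\<phi> m \<in> borel_measurable borel" for m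
    by (intro borel_measurable_continuous_onI cont)
  have [measurable]: "C \<in> sets borel" "G \<in> borel_measurable M" using C G by auto
  have lim: "(\<lambda>m. \<phi> m z) \<longlonglongrightarrow> indicator C z" for z
  proof (cases "z \<in> C")
    case True
    thus ?thesis by (simp add: \<phi>_def)
  next
    case False
    hence pos: "infdist z C > 0"
      using C infdist_pos_not_in_closed by blast
    obtain N where N: "1 / infdist z C < real N" using reals_Archimedean2 by blast
    have "\<phi> m z = indicator C z" if "m \<ge> N" for m
    proof -
      have "1 / infdist z C \<le> real m" using N that by simp
      hence "1 \<le> real m * infdist z C" using pos by (simp add: field_simps)
      thus ?thesis using False by (simp add: \<phi>_def)
    qed
    thus ?thesis
      by (intro tendsto_eventually eventually_sequentiallyI)
  qed
  have "(\<lambda>m. LINT x|M. G x * of_real (\<phi> m (cis (T x)))) \<longlonglongrightarrow> (LINT x|M. G x * of_real (indicator C (cis (T x))))"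
  proof (rule integral_dominated_convergence[where w = "\<lambda>x. norm (G x)"])
    have "\<bar>\<phi> m z\<bar> \<le> 1" for m z
      by (simp add: \<phi>_def max_def infdist_nonneg)
    thus "AE x in M. norm (G x * of_real (\<phi> m (cis (T x)))) \<le> norm (G x)" for m
      by (auto simp: norm_mult intro!: mult_left_le)
    show "AE x in M. (\<lambda>m. G x * of_real (\<phi> m (cis (T x)))) \<longlonglongrightarrow> G x * of_real (indicator C (cis (T x)))"
      by (intro AE_I2 tendsto_intros lim)
  qed (use G in auto)
  moreover have "(LINT x|M. G x * of_real (\<phi> m (cis (T x)))) = 0" for m
    using cont T G by (rule fourier_zero_mult_continuous)
  ultimately show ?thesis by (simp add: LIMSEQ_const_iff)
qed

text \<open>A pi-lambda argument for the complex set function that integrates \<open>G\<close> over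
  preimages. \<open>T\<close> is general so as to serve both for a single coordinate and for the
  identity of the product space.\<close>

lemma set_integral_zero_generator:
  fixes G :: "'a \<Rightarrow> complex"
  assumes G: "integrable M G" and T [measurable]: "T \<in> measurable M N"
    and sets: "sets N = sigma_sets (space N) \<Gamma>" and \<Gamma>: "Int_stable \<Gamma>" "\<Gamma> \<subseteq> Pow (space N)"
    and zero: "\<And>A. A \<in> \<Gamma> \<Longrightarrow> (LINT x:(T -` A \<inter> space M)|M. G x) = 0" and total: "(LINT x|M. G x) = 0"
    and A: "A \<in> sets N"
  shows "(LINT x:(T -` A \<inter> space M)|M. G x) = 0"
proof -
  have si: "set_integrable M (T -` A \<inter> space M) G" if "A \<in> sets N" for A
    unfolding set_integrable_def using that by (intro integrable_mult_indicator G) measurable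
  have "A \<in> sigma_sets (space N) \<Gamma>" using A sets by simp
  thus ?thesis
  proof (induction rule: sigma_sets_induct_disjoint[OF \<Gamma>, consumes 1, case_names basic empty compl union])
    case empty
    thus ?case by (simp add: set_lebesgue_integral_def)
  next
    case (compl A)
    hence A: "A \<in> sets N" using sets by simp
    have "(LINT x:(T -` (space N - A) \<inter> space M)|M. G x) = (LINT x|M. G x - indicator (T -` A \<inter> space M) x *\<^sub>R G x)"
      unfolding set_lebesgue_integral_def
      using measurable_space[OF T] by (intro Bochner_Integration.integral_cong) (auto simp: indicator_def)
    also have "\<dots> = 0"
      using si[OF A] G compl.IH total by (simp add: set_integrable_def set_lebesgue_integral_def)
    finally show ?case .
  next
    case (union A)
    hence A: "A i \<in> sets N" for i using sets by auto
    have eq: "T -` (\<Union>i. A i) \<inter> space M = (\<Union>i. T -` A i \<inter> space M)" by auto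
    have "(LINT x:(\<Union>i. T -` A i \<inter> space M)|M. G x) = (\<Sum>i. (LINT x:(T -` A i \<inter> space M)|M. G x))"
    proof (rule lebesgue_integral_countable_add)
      show "T -` A i \<inter> space M \<in> sets M" for i using A by measurable
      show "(T -` A i \<inter> space M) \<inter> (T -` A j \<inter> space M) = {}" if "i \<noteq> j" for i j
        using union(1) that by (auto simp: disjoint_family_on_def)
      show "set_integrable M (\<Union>i. T -` A i \<inter> space M) G"
        unfolding eq[symmetric] using A by (intro si) auto
    qed
    thus ?case unfolding eq using union.IH by simp
  qed (rule zero)
qed

text \<open>Half-lines generate the Borel sets, and within [0, 2 pi) a half-line is the preimage
  under \<open>cis\<close> of a closed arc, because \<open>cis\<close> is injective there.\<close>

lemma fourier_zero_indicator:
  fixes G :: "'a \<Rightarrow> complex"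
  assumes T [measurable]: "T \<in> borel_measurable M" and AE: "AE x in M. T x \<in> {0..<2*pi}"
  assumes G: "integrable M G" "\<And>k::int. (LINT x|M. G x * cis (real_of_int k * T x)) = 0"
  assumes E: "E \<in> sets borel"
  shows "(LINT x|M. G x * of_real (indicator E (T x))) = 0"
proof -
  have [measurable]: "G \<in> borel_measurable M" using G by auto
  have total: "(LINT x|M. G x) = 0" using G(2)[of 0] by simp
  have set: "(LINT x:(T -` E \<inter> space M)|M. G x) = (LINT x|M. G x * of_real (indicator E (T x)))" for E
    unfolding set_lebesgue_integral_def by (intro Bochner_Integration.integral_cong) (auto simp: indicator_def)
  have half: "(LINT x|M. G x * of_real (indicator {..a} (T x))) = 0" for a
  proof -
    consider "a < 0" | "a \<ge> 2*pi" | "0 \<le> a" "a < 2*pi" by linarith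
    thus ?thesis
    proof cases
      case 1
      have "(LINT x|M. G x * of_real (indicator {..a} (T x))) = (LINT x|M. 0)"
        using AE 1 by (intro integral_cong_AE) auto
      thus ?thesis by simp
    next
      case 2
      have "(LINT x|M. G x * of_real (indicator {..a} (T x))) = (LINT x|M. G x)"
        using AE 2 by (intro integral_cong_AE) auto
      thus ?thesis using total by simp
    next
      case 3
      define C where "C = cis ` {0..a}"
      have "compact C" unfolding C_def by (intro compact_continuous_image continuous_intros) auto
      hence C: "closed C" by (rule compact_imp_closed)
      hence [measurable]: "C \<in> sets borel" by auto
      have mem: "cis s \<in> C \<longleftrightarrow> s \<le> a" if "s \<in> {0..<2*pi}" for s
      proof
        assume "cis s \<in> C"
        then obtain u where u: "u \<in> {0..a}" "cis s = cis u" by (auto simp: C_def)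
        hence "s = u" using that 3 by (intro cis_inj_0_2pi) auto
        thus "s \<le> a" using u by simp
      qed (use that in \<open>auto simp: C_def\<close>)
      have "(LINT x|M. G x * of_real (indicator {..a} (T x))) = (LINT x|M. G x * of_real (indicator C (cis (T x))))"
        using AE by (intro integral_cong_AE) (auto simp: indicator_def mem)
      also have "\<dots> = 0"
        using C T G 3 by (intro fourier_zero_indicator_closed) (auto simp: C_def)
      finally show ?thesis .
    qed
  qed
  have "(LINT x:(T -` E \<inter> space M)|M. G x) = 0"
  proof (rule set_integral_zero_generator[OF G(1) T])
    show "sets (borel :: real measure) = sigma_sets (space borel) (range atMost)"
      by (subst borel_eq_atMost) simp
    show "Int_stable (range atMost :: real set set)"
      by (auto simp: Int_stable_def)
  qed (use half total E in \<open>auto simp: set\<close>)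
  thus ?thesis unfolding set .
qed

lemma AE_torus_component:
  assumes "j \<in> J"
  shows "AE t in torus J. t j \<in> {0..<2*pi}"
proof -
  interpret product_prob_space "\<lambda>_::nat. unif" J ..
  show ?thesis
    unfolding torus_def using assms by (intro AE_component AE_uniform_measureI) auto
qed

text \<open>Coordinates are converted one at a time from characters to indicators. All other factors
  are absorbed into \<open>G\<close>, whose Fourier coefficients in the single angle t j vanish by
  the induction hypothesis.\<close>

lemma fourier_zero_box:
  assumes J: "finite J" and g: "integrable (torus J) g"
    and zero: "\<And>n. n \<in> mindex J \<Longrightarrow> (LINT t|torus J. g t * character n t) = 0"
    and "B \<subseteq> J" "\<And>j. j \<in> B \<Longrightarrow> E j \<in> sets borel" "n \<in> mindex (J - B)"
  shows "(LINT t|torus J. g t * of_real (\<Prod>j\<in>B. indicator (E j) (t j)) * character n t) = 0"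
proof -
  have "finite B" using \<open>B \<subseteq> J\<close> J by (rule finite_subset)
  thus ?thesis using assms(4-6)
  proof (induction B arbitrary: n)
    case empty
    thus ?case using zero[of n] by simp
  next
    case (insert j B)
    define h where "h t = of_real (\<Prod>j\<in>B. indicator (E j) (t j)) * character n t" for t
    define G where "G t = g t * h t" for t
    have j: "j \<in> J" and n: "n \<in> mindex J" "n j = 0" "finite (supp n)"
      using insert.prems by (auto simp: mindex_def supp_def)
    have [measurable]: "character n \<in> borel_measurable (torus J)" using n by measurable
    have hm: "h \<in> borel_measurable (torus J)"
      unfolding h_def using insert.prems by (auto intro!: borel_measurable_times borel_measurable_prod measurable_compose[OF measurable_torus_component] simp: of_real_prod)
    have "norm (h t) \<le> 1" for t
      unfolding h_def norm_mult norm_of_real abs_prod by (auto simp: indicator_def intro!: prod_le_1)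
    hence G: "integrable (torus J) G"
      unfolding G_def using g hm by (intro integrable_mult_bounded) auto
    have coeff: "(LINT t|torus J. G t * cis (real_of_int k * t j)) = 0" for k
    proof -
      let ?n = "n(j := k)"
      have "supp ?n \<subseteq> insert j (supp n)" by (auto simp: supp_def)
      hence nk: "?n \<in> mindex (J - B)"
        using insert.prems insert.hyps n j by (auto simp: mindex_def intro: finite_subset)
      have "n(j := 0) = n" using n by auto
      hence char: "character ?n t = cis (real_of_int k * t j) * character n t" for t
        using character_upd[of ?n t j "t j"] mindexD(1)[OF nk] by simp
      have "(LINT t|torus J. g t * of_real (\<Prod>j\<in>B. indicator (E j) (t j)) * character ?n t) = 0"
        using insert.prems by (intro insert.IH nk) auto
      thus ?thesis unfolding char G_def h_def by (simp only: mult_ac)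
    qed
    have "(LINT t|torus J. G t * of_real (indicator (E j) (t j))) = 0"
      using measurable_torus_component[OF j] AE_torus_component[OF j] G coeff
      by (rule fourier_zero_indicator) (use insert.prems in auto)
    thus ?case
      using insert.hyps by (simp add: G_def h_def mult_ac)
  qed
qed

text \<open>\<open>is_Pm\<close> describes its result by Fourier coefficients only, so bounding
  \<open>K_P1\<close> needs that they determine an integrable function of finitely many variables.
  Boxes generate the product sigma-algebra, hence all set integrals vanish.\<close>

lemma fourier_zero_imp_AE_zero:
  assumes J: "finite J" and g: "integrable (torus J) g"
    and zero: "\<And>n. n \<in> mindex J \<Longrightarrow> fourier J g n = 0"
  shows "AE t in torus J. g t = 0"
proof -
  have zero': "(LINT t|torus J. g t * character n t) = 0" if "n \<in> mindex J" for n
  proof -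
    have "(\<lambda>j. - n j) \<in> mindex J" using that by (simp add: mindex_def supp_def)
    from zero[OF this] show ?thesis by (simp add: fourier_def cnj_character)
  qed
  have set: "(LINT t:A|torus J. g t) = 0" if "A \<in> sets (torus J)" for A
  proof -
    have "(LINT t:((\<lambda>t. t) -` A \<inter> space (torus J))|torus J. g t) = 0"
    proof (rule set_integral_zero_generator[OF g measurable_ident_sets[OF refl] _ _ _ _ _ that])
      show "sets (torus J) = sigma_sets (space (torus J)) (prod_algebra J (\<lambda>_. unif))"
        by (simp add: torus_def sets_PiM space_PiM)
      show "Int_stable (prod_algebra J (\<lambda>_. unif))"
        by (rule Int_stable_prod_algebra)
      show "prod_algebra J (\<lambda>_. unif) \<subseteq> Pow (space (torus J))"
        using prod_algebra_sets_into_space[of J "\<lambda>_. unif"] by (simp add: torus_def space_PiM)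
      show "(LINT t|torus J. g t) = 0"
        using zero'[of "\<lambda>_. 0"] by (simp add: mindex_def)
      fix A assume "A \<in> prod_algebra J (\<lambda>_. unif)"
      then obtain E where E: "A = Pi\<^sub>E J E" "\<And>j. j \<in> J \<Longrightarrow> E j \<in> sets borel"
        unfolding prod_algebra_eq_finite[OF J] by auto
      have ind: "indicator A t = (\<Prod>j\<in>J. indicator (E j) (t j) :: real)" if "t \<in> space (torus J)" for t
        using that J unfolding E(1)
        by (auto simp: indicator_def space_torus PiE_def intro!: prod.neutral)
      have "(LINT t:((\<lambda>t. t) -` A \<inter> space (torus J))|torus J. g t)
          = (LINT t|torus J. g t * of_real (\<Prod>j\<in>J. indicator (E j) (t j)) * character (\<lambda>_. 0) t)"
        unfolding set_lebesgue_integral_def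
        by (intro Bochner_Integration.integral_cong refl, subst ind[symmetric]) (auto simp: indicator_def)
      also have "\<dots> = 0"
        using J g zero' subset_refl E(2) by (rule fourier_zero_box) (auto simp: mindex_def)
      finally show "(LINT t:((\<lambda>t. t) -` A \<inter> space (torus J))|torus J. g t) = 0" .
    qed
    moreover have "(\<lambda>t. t) -` A \<inter> space (torus J) = A" using sets.sets_into_space[OF that] by auto
    ultimately show ?thesis by simp
  qed
  have si: "integrable (torus J) (\<lambda>t. indicator A t *\<^sub>R g t)" if "A \<in> sets (torus J)" for A
    using that g by (rule integrable_mult_indicator)
  have "AE t in torus J. Re (g t) = 0"
  proof (rule density_unique_real)
    show "(LINT t:A|torus J. Re (g t)) = (LINT t:A|torus J. 0)" if "A \<in> sets (torus J)" for A
      using integral_Re[OF si[OF that]] set[OF that] by (simp add: set_lebesgue_integral_def)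
  qed (use g in auto)
  moreover have "AE t in torus J. Im (g t) = 0"
  proof (rule density_unique_real)
    show "(LINT t:A|torus J. Im (g t)) = (LINT t:A|torus J. 0)" if "A \<in> sets (torus J)" for A
      using integral_Im[OF si[OF that]] set[OF that] by (simp add: set_lebesgue_integral_def)
  qed (use g in auto)
  ultimately show ?thesis by eventually_elim (simp add: complex_eq_iff)
qed

section \<open>Fourier coefficients of trigonometric polynomials\<close>

lemma integral_torus_restrict:
  fixes f :: "(nat \<Rightarrow> real) \<Rightarrow> 'a::{banach, second_countable_topology}"
  assumes "finite J" "J \<subseteq> I" and f: "f \<in> borel_measurable (torus J)" "\<And>t. f (restrict t J) = f t"
  shows "(LINT t|torus I. f t) = (LINT t|torus J. f t)"
proof -
  interpret product_prob_space "\<lambda>_::nat. unif" I ..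
  have m: "(\<lambda>t. restrict t J) \<in> measurable (torus I) (torus J)"
    unfolding torus_def using assms(2) by (rule measurable_restrict_subset)
  have "torus J = distr (torus I) (torus J) (\<lambda>t. restrict t J)"
    unfolding torus_def using assms(1,2) by (rule distr_PiM_restrict_finite[symmetric])
  hence "(LINT t|torus J. f t) = (LINT t|distr (torus I) (torus J) (\<lambda>t. restrict t J). f t)"
    by simp
  also have "\<dots> = (LINT t|torus I. f (restrict t J))"
    using m f(1) by (rule integral_distr)
  finally show ?thesis by (simp add: f(2))
qed

lemma character_restrict: "supp n \<subseteq> J \<Longrightarrow> character n (restrict t J) = character n t"
  by (rule character_cong) auto

lemma integral_character:
  assumes n: "n \<in> mindex I"
  shows "(LINT t|torus I. character n t) = (if n = (\<lambda>_. 0) then 1 else 0)"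
proof (cases "n = (\<lambda>_. 0)")
  case True
  thus ?thesis by (simp add: torus.prob_space)
next
  case False
  then obtain i where i: "i \<in> supp n" by (auto simp: supp_def fun_eq_iff)
  let ?J = "supp n - {i}"
  note fin = mindexD(1)[OF n]
  have J: "insert i ?J = supp n" using i by auto
  have mem: "n \<in> mindex (supp n)" using fin by (simp add: mindex_def)
  have "(LINT t|torus I. character n t) = (LINT t|torus (supp n). character n t)"
    using fin mindexD(2)[OF n] mem by (intro integral_torus_restrict measurable_character character_restrict) auto
  also have "\<dots> = (LINT s|unif. LINT t|torus ?J. character n (t(i := s)))"
    using integral_torus_insert[of ?J i "character n" 1] fin mem unfolding J by auto
  also have "\<dots> = (LINT s|unif. cis (real_of_int (n i) * s) * (LINT t|torus ?J. character (n(i := 0)) t))"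
    using fin by (simp add: character_upd)
  also have "\<dots> = (LINT s|unif. cis (real_of_int (n i) * s)) * (LINT t|torus ?J. character (n(i := 0)) t)"
    by simp
  also have "\<dots> = 0"
    using i by (simp add: integral_unif_cis supp_def)
  finally show ?thesis using False by simp
qed

lemma fourier_trigsum:
  assumes "finite F" and p: "\<And>k. k \<in> F \<Longrightarrow> p k \<in> mindex I" and n: "n \<in> mindex I"
  shows "fourier I (trigsum F c p) n = (\<Sum>k | k \<in> F \<and> p k = n. c k)"
proof -
  have *: "character (p k) t * cnj (character n t) = character (\<lambda>j. p k j - n j) t"
    and mem: "(\<lambda>j. p k j - n j) \<in> mindex I" if "k \<in> F" for k t
  proof -
    have "supp (\<lambda>j. p k j - n j) \<subseteq> supp (p k) \<union> supp n" by (auto simp: supp_def)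
    thus "(\<lambda>j. p k j - n j) \<in> mindex I"
      using p[OF that] n unfolding mindex_def by (auto intro: finite_subset)
    have "finite (supp (\<lambda>j. - n j))" using mindexD(1)[OF n] by (simp add: supp_def)
    thus "character (p k) t * cnj (character n t) = character (\<lambda>j. p k j - n j) t"
      using mindexD(1)[OF p[OF that]] by (simp add: cnj_character character_mult)
  qed
  have "fourier I (trigsum F c p) n = (LINT t|torus I. (\<Sum>k\<in>F. c k * character (\<lambda>j. p k j - n j) t))"
    unfolding fourier_def trigsum_def sum_distrib_right
    by (intro Bochner_Integration.integral_cong sum.cong) (auto simp: * mult.assoc)
  also have "\<dots> = (\<Sum>k\<in>F. c k * (LINT t|torus I. character (\<lambda>j. p k j - n j) t))"
    using mem by (subst Bochner_Integration.integral_sum)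
      (auto intro!: integrable_mult_right integrable_torus_bounded[where B = 1] measurable_character)
  also have "\<dots> = (\<Sum>k\<in>F. if p k = n then c k else 0)"
    by (intro sum.cong) (auto simp: integral_character[OF mem] fun_eq_iff)
  also have "\<dots> = (\<Sum>k | k \<in> F \<and> p k = n. c k)"
    using assms(1) by (simp add: sum.inter_filter)
  finally show ?thesis .
qed

section \<open>The constant K and projections on blocks of variables\<close>

lemma is_Pm_trigsum:
  assumes "finite F" "\<And>k. k \<in> F \<Longrightarrow> p k \<in> mindex I"
  shows "is_Pm I m (trigsum F c p) (trigsum {k \<in> F. card (supp (p k)) = m} c p)"
proof -
  have "(\<Sum>k | k \<in> {k \<in> F. card (supp (p k)) = m} \<and> p k = n. c k)
      = (if card (supp n) = m then (\<Sum>k | k \<in> F \<and> p k = n. c k) else 0)" for n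
    by (auto intro!: sum.cong sum.neutral)
  moreover have "fourier I (trigsum {k \<in> F. card (supp (p k)) = m} c p) n
      = (\<Sum>k | k \<in> {k \<in> F. card (supp (p k)) = m} \<and> p k = n. c k)"
    "fourier I (trigsum F c p) n = (\<Sum>k | k \<in> F \<and> p k = n. c k)" if "n \<in> mindex I" for n
    using assms that by (auto intro!: fourier_trigsum simp del: mem_Collect_eq)
  moreover have "integrable (torus I) (trigsum {k \<in> F. card (supp (p k)) = m} c p)"
    using assms by (intro integrable_trigsum) auto
  ultimately show ?thesis by (simp add: is_Pm_def)
qed

lemma l1norm_nonneg [simp]: "l1norm I f \<ge> 0"
  by (simp add: l1norm_def)

lemma l1norm_cong: "(\<And>t. t \<in> space (torus I) \<Longrightarrow> f t = g t) \<Longrightarrow> l1norm I f = l1norm I g"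
  unfolding l1norm_def by (intro Bochner_Integration.integral_cong) auto

lemma fourier_cong: "(\<And>t. t \<in> space (torus I) \<Longrightarrow> f t = g t) \<Longrightarrow> fourier I f n = fourier I g n"
  unfolding fourier_def by (intro Bochner_Integration.integral_cong) auto

lemma integrable_mult_cnj_character:
  assumes "integrable (torus I) f" "n \<in> mindex I"
  shows "integrable (torus I) (\<lambda>t. f t * cnj (character n t))"
proof -
  have "(\<lambda>j. - n j) \<in> mindex I" using assms(2) by (simp add: mindex_def supp_def)
  thus ?thesis
    unfolding cnj_character using assms(1) by (intro integrable_mult_bounded[where B = 1]) auto
qed

lemma fourier_diff:
  assumes "integrable (torus I) f" "integrable (torus I) g" "n \<in> mindex I"
  shows "fourier I (\<lambda>t. f t - g t) n = fourier I f n - fourier I g n"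
  using assms by (simp add: fourier_def left_diff_distrib integrable_mult_cnj_character)

text \<open>The pair estimate at y = 0: dropping the first slot leaves P_1 f, and the summand norm a
  is outweighed by - 108 * norm a.\<close>

lemma l1norm_P1_le:
  fixes F :: "'k set"
  assumes "finite J" "finite F" "\<And>k. k \<in> F \<Longrightarrow> p k \<in> amindex J"
  shows "l1norm J (trigsum {k \<in> F. card (supp (p k)) = 1} c p) \<le> 108 * l1norm J (trigsum F c p)"
proof -
  define a where "a = (\<Sum>k | k \<in> F \<and> supp (p k) = {}. c k)"
  let ?g = "trigsum {k \<in> F. card (supp (p k)) = 1} c p"
  have g: "integrable (torus J) ?g"
    using assms(3) by (intro integrable_trigsum amindex_imp_mindex) auto
  have "l1norm J ?g \<le> (LINT t|torus J. norm (a, 0 + ?g t))"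
    unfolding l1norm_def
    using g by (intro integral_mono integrable_norm integrable_Pair) (auto intro: norm_snd_le)
  also have "\<dots> \<le> norm (a, 0::complex) + 108 * (l1norm J (trigsum F c p) - norm a)"
    unfolding a_def l1norm_def using assms by (rule integral_P1_pair_le)
  also have "\<dots> \<le> 108 * l1norm J (trigsum F c p)"
    by (simp add: norm_Pair)
  finally show ?thesis .
qed

lemma is_Pm_AE_unique:
  assumes "finite J" "is_Pm J m f g" "is_Pm J m f h"
  shows "AE t in torus J. g t = h t"
proof -
  have "AE t in torus J. g t - h t = 0"
    using assms by (intro fourier_zero_imp_AE_zero) (auto simp: is_Pm_def fourier_diff)
  thus ?thesis by simp
qed

text \<open>The supremum runs over all representatives g of P_1 f. By uniqueness of Fourier
  coefficients each of them agrees almost everywhere with the explicit partial sum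
  \<open>?h\<close>.\<close>

lemma K_P1_le: "K_P1 \<le> 108"
  unfolding K_P1_def
proof (rule SUP_least, clarify)
  fix N :: nat and f g
  let ?J = "{..<N}"
  assume f: "apoly ?J f" "l1norm ?J f \<noteq> 0" and g: "is_Pm ?J 1 f g"
  obtain F c where F: "finite F" "F \<subseteq> amindex ?J" "\<And>t. t \<in> space (torus ?J) \<Longrightarrow> f t = trigsum F c (\<lambda>n. n) t"
    using f(1) by (auto simp: apoly_def trigsum_def)
  let ?h = "trigsum {k \<in> F. card (supp k) = 1} c (\<lambda>n. n)"
  have mem: "n \<in> amindex ?J" "n \<in> mindex ?J" if "n \<in> F" for n
    using F(2) that by (auto simp: amindex_def)
  have "is_Pm ?J 1 f ?h"
    using is_Pm_trigsum[OF F(1), of "\<lambda>n. n" ?J 1 c] mem fourier_cong[OF F(3)] by (simp add: is_Pm_def)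
  hence "AE t in torus ?J. g t = ?h t" using g by (intro is_Pm_AE_unique) auto
  moreover have "g \<in> borel_measurable (torus ?J)" "?h \<in> borel_measurable (torus ?J)"
    using g \<open>is_Pm ?J 1 f ?h\<close> by (auto simp: is_Pm_def)
  ultimately have "l1norm ?J g = l1norm ?J ?h"
    unfolding l1norm_def by (intro integral_cong_AE) auto
  also have "\<dots> \<le> 108 * l1norm ?J (trigsum F c (\<lambda>n. n))"
    using F(1) mem by (intro l1norm_P1_le) auto
  also have "l1norm ?J (trigsum F c (\<lambda>n. n)) = l1norm ?J f"
    using F(3) by (intro l1norm_cong) auto
  finally have "l1norm ?J g / l1norm ?J f \<le> 108"
    using f(2) l1norm_nonneg[of ?J f] by (subst pos_divide_le_eq) (auto simp: order_less_le)
  thus "ereal (l1norm ?J g / l1norm ?J f) \<le> 108"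
    using ereal_less_eq(3)[of "l1norm ?J g / l1norm ?J f" 108] by simp
qed

lemma apoly_trigsum:
  assumes "finite F" "\<And>k. k \<in> F \<Longrightarrow> p k \<in> amindex I"
  shows "apoly I (trigsum F c p)"
  unfolding apoly_def
proof (intro exI conjI ballI)
  show "finite (p ` F)" "p ` F \<subseteq> amindex I" using assms by auto
  fix t
  show "trigsum F c p t = (\<Sum>n\<in>p ` F. (\<Sum>k | k \<in> F \<and> p k = n. c k) * character n t)"
    unfolding trigsum_def
    by (subst sum.image_gen[OF assms(1), where g = p]) (auto simp: sum_distrib_right intro!: sum.cong)
qed

abbreviation K1 :: real where "K1 \<equiv> real_of_ereal K_P1"

text \<open>\<open>real_of_ereal\<close> sends infinity to 0, so the passage from
  \<open>K_P1\<close> to the real number \<open>K1\<close> rests on the finiteness of the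
  supremum.\<close>

lemma ratio_le_K1:
  assumes "finite F" "\<And>k. k \<in> F \<Longrightarrow> p k \<in> amindex {..<N}" "l1norm {..<N} (trigsum F c p) \<noteq> 0"
  shows "l1norm {..<N} (trigsum {k \<in> F. card (supp (p k)) = 1} c p) / l1norm {..<N} (trigsum F c p) \<le> K1"
    (is "?r \<le> _")
proof -
  have "apoly {..<N} (trigsum F c p)" "is_Pm {..<N} 1 (trigsum F c p) (trigsum {k \<in> F. card (supp (p k)) = 1} c p)"
    using assms(1,2) by (auto intro!: apoly_trigsum is_Pm_trigsum amindex_imp_mindex)
  hence "ereal ?r \<le> K_P1"
    unfolding K_P1_def using assms(3) by (intro SUP_upper CollectI) blast
  moreover have "r \<le> real_of_ereal k" if "ereal r \<le> k" "k \<le> 108" for r k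
    using that by (cases k) auto
  ultimately show ?thesis using K_P1_le by blast
qed

lemma K1_nonneg: "K1 \<ge> 0"
proof -
  let ?f = "trigsum {()} (\<lambda>_. 1) (\<lambda>_ _. 0)"
  have "?f = (\<lambda>_. 1)" by (simp add: trigsum_def fun_eq_iff)
  hence "l1norm {..<0} ?f = 1" by (simp add: l1norm_def torus.prob_space)
  thus ?thesis
    using ratio_le_K1[of "{()}" "\<lambda>_ _. 0" 0 "\<lambda>_. 1"]
    by (intro order_trans[OF _ ratio_le_K1[of "{()}" "\<lambda>_ _. 0" 0 "\<lambda>_. 1"]])
      (auto simp: amindex_def mindex_def)
qed

lemma l1norm_P1_le_K1:
  assumes "finite F" "\<And>k. k \<in> F \<Longrightarrow> p k \<in> amindex {..<N}"
  shows "l1norm {..<N} (trigsum {k \<in> F. card (supp (p k)) = 1} c p) \<le> K1 * l1norm {..<N} (trigsum F c p)"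
proof (cases "l1norm {..<N} (trigsum F c p) = 0")
  case True
  \<comment> \<open>The supremum excludes a vanishing denominator; the explicit constant 108 shows
    that the left side vanishes as well.\<close>
  thus ?thesis using l1norm_P1_le[of "{..<N}" F p c] assms by simp
next
  case False
  hence "l1norm {..<N} (trigsum F c p) > 0"
    using l1norm_nonneg[of "{..<N}" "trigsum F c p"] by linarith
  thus ?thesis using ratio_le_K1[OF assms False] by (simp add: pos_divide_le_eq)
qed

section \<open>Projections onto a block of coordinates\<close>

definition mix :: "nat set \<Rightarrow> nat set \<Rightarrow> (nat \<Rightarrow> real) \<Rightarrow> (nat \<Rightarrow> real) \<Rightarrow> nat \<Rightarrow> real" where
  "mix J A t u = (\<lambda>j\<in>J. if j \<in> A then u j else t j)"

lemma measurable_mix [measurable]: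
  "(\<lambda>(t, u). mix J A t u) \<in> measurable (torus J \<Otimes>\<^sub>M torus J) (torus J)"
proof -
  have "(\<lambda>z. \<lambda>j\<in>J. if j \<in> A then snd z j else fst z j)
      \<in> measurable (PiM J (\<lambda>_. unif) \<Otimes>\<^sub>M PiM J (\<lambda>_. unif)) (PiM J (\<lambda>_. unif))"
    by (intro measurable_restrict) (auto intro: measurable_compose[OF measurable_snd] measurable_compose[OF measurable_fst])
  thus ?thesis by (simp add: torus_def mix_def case_prod_beta')
qed

text \<open>Resampling the coordinates in A from an independent copy preserves the law. On a box
  each coordinate is constrained in exactly one of the two copies, so the product of the two
  measures is that of the box.\<close>

lemma distr_mix:
  assumes "finite J"
  shows "distr (torus J \<Otimes>\<^sub>M torus J) (torus J) (\<lambda>(t, u). mix J A t u) = torus J"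
  unfolding torus_def
proof (rule product_sigma_finite.PiM_eqI)
  interpret product_sigma_finite "\<lambda>_::nat. unif" ..
  show "product_sigma_finite (\<lambda>_::nat. unif)" ..
  fix X :: "nat \<Rightarrow> real set" assume X: "\<And>j. j \<in> J \<Longrightarrow> X j \<in> sets unif"
  define Y where "Y j = (if j \<in> A then UNIV else X j)" for j
  define Z where "Z j = (if j \<in> A then X j else UNIV)" for j
  have YZ: "Y j \<in> sets unif" "Z j \<in> sets unif" if "j \<in> J" for j
    using X[OF that] by (auto simp: Y_def Z_def)
  have eq: "(\<lambda>(t, u). mix J A t u) -` Pi\<^sub>E J X \<inter> space (torus J \<Otimes>\<^sub>M torus J) = Pi\<^sub>E J Y \<times> Pi\<^sub>E J Z"
    by (auto simp: space_pair_measure space_torus mix_def Y_def Z_def PiE_iff extensional_def split: if_splits)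
  have box: "Pi\<^sub>E J X \<in> sets (torus J)" "Pi\<^sub>E J Y \<in> sets (torus J)" "Pi\<^sub>E J Z \<in> sets (torus J)"
    unfolding torus_def using X YZ assms by (auto intro!: sets_PiM_I_finite)
  have "emeasure (distr (torus J \<Otimes>\<^sub>M torus J) (torus J) (\<lambda>(t, u). mix J A t u)) (Pi\<^sub>E J X)
      = emeasure (torus J) (Pi\<^sub>E J Y) * emeasure (torus J) (Pi\<^sub>E J Z)"
    using box by (subst emeasure_distr) (auto simp: eq torus.emeasure_pair_measure_Times)
  also have "\<dots> = (\<Prod>j\<in>J. emeasure unif (Y j) * emeasure unif (Z j))"
    unfolding torus_def using YZ assms by (simp only: emeasure_PiM prod.distrib)
  also have "\<dots> = (\<Prod>j\<in>J. emeasure unif (X j))"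
    using unif.emeasure_space_1 by (intro prod.cong) (auto simp: Y_def Z_def simp del: emeasure_uniform_measure)
  finally show "emeasure (distr (PiM J (\<lambda>_. unif) \<Otimes>\<^sub>M PiM J (\<lambda>_. unif)) (PiM J (\<lambda>_. unif)) (\<lambda>(t, u). mix J A t u)) (Pi\<^sub>E J X)
      = (\<Prod>j\<in>J. emeasure unif (X j))"
    unfolding torus_def .
qed (use assms in auto)

lemma integral_mix:
  fixes f :: "(nat \<Rightarrow> real) \<Rightarrow> real"
  assumes "finite J" and f [measurable]: "f \<in> borel_measurable (torus J)" and B: "\<And>t. norm (f t) \<le> B"
  shows "(LINT t|torus J. f t) = (LINT t|torus J. LINT u|torus J. f (mix J A t u))"
    and "integrable (torus J) (\<lambda>t. LINT u|torus J. f (mix J A t u))"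
proof -
  interpret P: pair_prob_space "torus J" "torus J" ..
  have i: "integrable (torus J \<Otimes>\<^sub>M torus J) (\<lambda>z. f ((\<lambda>(t, u). mix J A t u) z))"
    using B by (intro P.integrable_const_bound[where B = B]) auto
  have "(LINT t|torus J. f t) = (LINT t|distr (torus J \<Otimes>\<^sub>M torus J) (torus J) (\<lambda>(t, u). mix J A t u). f t)"
    using distr_mix[OF assms(1)] by simp
  also have "\<dots> = (LINT z|(torus J \<Otimes>\<^sub>M torus J). f ((\<lambda>(t, u). mix J A t u) z))"
    by (rule integral_distr) measurable
  also have "\<dots> = (LINT t|torus J. LINT u|torus J. f (mix J A t u))"
    using P.integral_fst'[OF i] by simp
  finally show "(LINT t|torus J. f t) = (LINT t|torus J. LINT u|torus J. f (mix J A t u))" .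
  show "integrable (torus J) (\<lambda>t. LINT u|torus J. f (mix J A t u))"
    using P.integrable_fst'[OF i] by simp
qed

lemma character_mix:
  assumes "n \<in> mindex J" "finite J"
  shows "character n (mix J A t u) =
    character (\<lambda>j. if j \<in> A then 0 else n j) t * character (\<lambda>j. if j \<in> A then n j else 0) u"
proof -
  have "supp n \<subseteq> J" using assms by (auto simp: mindex_def)
  moreover have "supp (\<lambda>j. if j \<in> A then 0 else n j) \<subseteq> supp n" "supp (\<lambda>j. if j \<in> A then n j else 0) \<subseteq> supp n"
    by (auto simp: supp_def)
  ultimately show ?thesis
    using assms(2)
    by (subst (1 2 3) character_eq_cis_sum[of J])
      (auto simp: cis_mult mix_def simp flip: sum.distrib intro!: arg_cong[of _ _ cis] sum.cong)
qed

text \<open>With t fixed, the variables outside A turn into coefficients, and the block projection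
  becomes P_1 in u. The bound by \<open>K1\<close> holds on each fibre and is integrated over
  t.\<close>

lemma l1norm_P1_block_le:
  fixes F :: "'k set"
  assumes "finite F" and p: "\<And>k. k \<in> F \<Longrightarrow> p k \<in> amindex {..<N}"
  shows "l1norm {..<N} (trigsum {k \<in> F. card (supp (p k) \<inter> A) = 1} c p) \<le> K1 * l1norm {..<N} (trigsum F c p)"
proof -
  let ?J = "{..<N}" and ?G = "{k \<in> F. card (supp (p k) \<inter> A) = 1}"
  define pA where "pA k j = (if j \<in> A then p k j else 0)" for k j
  define pB where "pB k j = (if j \<in> A then 0 else p k j)" for k j
  define d where "d t k = c k * character (pB k) t" for t k
  have supp: "supp (pA k) = supp (p k) \<inter> A" for k
    by (auto simp: supp_def pA_def)
  have pA: "pA k \<in> amindex ?J" if "k \<in> F" for k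
    using p[OF that] unfolding amindex_def mindex_def by (auto simp: supp pA_def)
  have mix: "trigsum G c p (mix ?J A t u) = trigsum G (d t) pA u" if "G \<subseteq> F" for G t u
    unfolding trigsum_def using that p
    by (intro sum.cong) (auto simp: d_def character_mix[OF amindex_imp_mindex] pA_def[abs_def] pB_def[abs_def])
  have int: "l1norm ?J (trigsum G c p) = (LINT t|torus ?J. l1norm ?J (trigsum G (d t) pA))"
    "integrable (torus ?J) (\<lambda>t. l1norm ?J (trigsum G (d t) pA))" if G: "G \<subseteq> F" for G
  proof -
    have [measurable]: "trigsum G c p \<in> borel_measurable (torus ?J)"
      using G p by (intro measurable_trigsum amindex_imp_mindex) auto
    have "(\<lambda>t. norm (trigsum G c p t)) \<in> borel_measurable (torus ?J)"
      by measurable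
    note * = integral_mix[OF _ this, where A = A and B = "\<Sum>k\<in>G. norm (c k)"]
    show "l1norm ?J (trigsum G c p) = (LINT t|torus ?J. l1norm ?J (trigsum G (d t) pA))"
      "integrable (torus ?J) (\<lambda>t. l1norm ?J (trigsum G (d t) pA))"
      using * norm_trigsum_le[of G c p] by (auto simp: l1norm_def mix[OF G])
  qed
  have "(LINT t|torus ?J. l1norm ?J (trigsum ?G (d t) pA)) \<le> (LINT t|torus ?J. K1 * l1norm ?J (trigsum F (d t) pA))"
    using int l1norm_P1_le_K1[OF assms(1) pA] by (intro integral_mono) (auto simp: supp)
  also have "\<dots> = K1 * (LINT t|torus ?J. l1norm ?J (trigsum F (d t) pA))"
    by simp
  finally show ?thesis
    using int(1)[of ?G] int(1)[of F] by simp
qed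

lemma l1norm_P1_blocks_le:
  fixes F :: "'k set" and col :: "nat \<Rightarrow> nat"
  assumes "finite F" and p: "\<And>k. k \<in> F \<Longrightarrow> p k \<in> amindex {..<N}"
  shows "l1norm {..<N} (trigsum {k \<in> F. \<forall>j<l. card (supp (p k) \<inter> col -` {j}) = 1} c p)
           \<le> K1 ^ l * l1norm {..<N} (trigsum F c p)"
proof (induction l)
  case (Suc l)
  let ?G = "{k \<in> F. \<forall>j<l. card (supp (p k) \<inter> col -` {j}) = 1}"
  have "{k \<in> F. \<forall>j<Suc l. card (supp (p k) \<inter> col -` {j}) = 1} = {k \<in> ?G. card (supp (p k) \<inter> col -` {l}) = 1}"
    by (auto simp: less_Suc_eq)
  hence "l1norm {..<N} (trigsum {k \<in> F. \<forall>j<Suc l. card (supp (p k) \<inter> col -` {j}) = 1} c p)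
      \<le> K1 * l1norm {..<N} (trigsum ?G c p)"
    using l1norm_P1_block_le[of ?G p N "col -` {l}" c] assms by simp
  also have "\<dots> \<le> K1 * (K1 ^ l * l1norm {..<N} (trigsum F c p))"
    using Suc.IH K1_nonneg by (rule mult_left_mono)
  finally show ?case by (simp add: mult_ac)
qed simp

section \<open>Averaging over colourings\<close>

text \<open>The m colour classes partition S, so one element in each forces card S = m. Conversely
  an injection of an m-element set into m colours is onto.\<close>

lemma rainbow_iff:
  fixes N m :: nat
  assumes col: "col \<in> {..<N} \<rightarrow>\<^sub>E {..<m}" and S: "S \<subseteq> {..<N}"
  shows "(\<forall>j<m. card (S \<inter> col -` {j}) = 1) \<longleftrightarrow> card S = m \<and> inj_on col S"
proof -
  have fin: "finite S" using finite_subset[OF S] by simp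
  have range: "col x < m" if "x \<in> S" for x using that col S by (auto simp: PiE_iff)
  show ?thesis
  proof
    assume L: "\<forall>j<m. card (S \<inter> col -` {j}) = 1"
    have "S = (\<Union>j<m. S \<inter> col -` {j})" using range by auto
    hence "card S = card (\<Union>j<m. S \<inter> col -` {j})" by (rule arg_cong)
    also have "\<dots> = (\<Sum>j<m. card (S \<inter> col -` {j}))"
      using fin by (intro card_UN_disjoint) auto
    also have "\<dots> = m" using L by simp
    finally have "card S = m" .
    moreover have "inj_on col S"
    proof
      fix x y assume xy: "x \<in> S" "y \<in> S" "col x = col y"
      then obtain z where "S \<inter> col -` {col x} = {z}"
        using L range[of x] by (metis card_1_singletonE)
      moreover have "x \<in> S \<inter> col -` {col x}" "y \<in> S \<inter> col -` {col x}" using xy by auto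
      ultimately have "x \<in> {z}" "y \<in> {z}" by (simp_all only:)
      thus "x = y" by simp
    qed
    ultimately show "card S = m \<and> inj_on col S" by simp
  next
    assume R: "card S = m \<and> inj_on col S"
    have "col ` S = {..<m}"
      using R range by (intro card_subset_eq) (auto simp: card_image)
    show "\<forall>j<m. card (S \<inter> col -` {j}) = 1"
    proof (intro allI impI)
      fix j assume "j < m"
      hence "j \<in> col ` S" using \<open>col ` S = {..<m}\<close> by simp
      then obtain x where "x \<in> S" "col x = j" by auto
      hence "S \<inter> col -` {j} = {x}" using R by (auto simp: inj_on_def)
      thus "card (S \<inter> col -` {j}) = 1" by simp
    qed
  qed
qed

text \<open>The colours on S form one of m! bijections, and those of the other N - m points are
  free. The count depends on S only through its size, which is why the sum over all colourings is a
  multiple of P_m.\<close>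

lemma card_rainbow:
  fixes N m :: nat
  assumes "S \<subseteq> {..<N}"
  shows "card {col \<in> {..<N} \<rightarrow>\<^sub>E {..<m}. \<forall>j<m. card (S \<inter> col -` {j}) = 1}
           = (if card S = m then m ^ (N - m) * fact m else 0)"
proof (cases "card S = m")
  case True
  have "{col \<in> {..<N} \<rightarrow>\<^sub>E {..<m}. \<forall>j<m. card (S \<inter> col -` {j}) = 1}
      = {col \<in> {..<N} \<rightarrow>\<^sub>E {..<m}. inj_on col S}"
    using True by (intro Collect_cong conj_cong refl) (subst rainbow_iff[OF _ assms], auto)
  also have "card \<dots> = m ^ (N - m) * prod ((-) m) {0..<m}"
    using assms True by (subst card_inj_on_subset_funcset) auto
  also have "prod ((-) m) {0..<m} = fact m"
    by (simp add: fact_prod_rev)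
  finally show ?thesis using True by simp
next
  case False
  hence "{col \<in> {..<N} \<rightarrow>\<^sub>E {..<m}. \<forall>j<m. card (S \<inter> col -` {j}) = 1} = {}"
    using rainbow_iff[OF _ assms] by blast
  thus ?thesis using False by (simp only: card.empty if_False)
qed

text \<open>The inductive step is (1 + 1/m)^m \<le> e. Compared with m^m / m! \<le> e^m from the
  exponential series this saves one factor e, the source of the 1/e in the final bound.\<close>

lemma power_self_le_fact: "m \<ge> 1 \<Longrightarrow> real m ^ m \<le> exp 1 ^ (m - 1) * fact m"
proof (induction m rule: nat_induct_at_least)
  case (Suc m)
  have "(real (Suc m)) ^ m = (1 + 1 / real m) ^ m * real m ^ m"
    using Suc by (simp add: field_simps flip: power_mult_distrib)
  also have "\<dots> \<le> exp (1 / real m) ^ m * real m ^ m"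
    by (intro mult_right_mono power_mono exp_ge_add_one_self_aux) auto
  also have "exp (1 / real m) ^ m = exp 1"
    using Suc by (simp flip: exp_of_nat_mult)
  also have "exp 1 * real m ^ m \<le> exp 1 * (exp 1 ^ (m - 1) * fact m)"
    using Suc by (intro mult_left_mono) auto
  also have "\<dots> = exp 1 ^ m * fact m"
    using Suc by (cases m) auto
  finally have "real (Suc m) * real (Suc m) ^ m \<le> real (Suc m) * (exp 1 ^ m * fact m)"
    by (intro mult_left_mono) auto
  thus ?case by (simp add: mult_ac)
qed simp

lemma l1norm_sum_le:
  assumes "\<And>i. i \<in> A \<Longrightarrow> integrable (torus I) (f i)"
  shows "l1norm I (\<lambda>t. \<Sum>i\<in>A. f i t) \<le> (\<Sum>i\<in>A. l1norm I (f i))"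
proof -
  have "l1norm I (\<lambda>t. \<Sum>i\<in>A. f i t) \<le> (LINT t|torus I. (\<Sum>i\<in>A. norm (f i t)))"
    unfolding l1norm_def using assms by (intro integral_mono) (auto intro: norm_sum)
  thus ?thesis unfolding l1norm_def using assms by simp
qed

text \<open>A rainbow colouring of the support puts exactly one element into each colour class, so the
  projections on the colour classes compose to a multiplier living on supports of size m.
  Averaging over all colourings recovers the whole of these supports.\<close>
lemma l1norm_Pm_le:
  fixes F :: "'k set"
  assumes "finite F" and p: "\<And>k. k \<in> F \<Longrightarrow> p k \<in> amindex {..<N}" and m: "m \<ge> 1"
  shows "l1norm {..<N} (trigsum {k \<in> F. card (supp (p k)) = m} c p)
           \<le> (1 / exp 1) * (exp 1 * K1) ^ m * l1norm {..<N} (trigsum F c p)"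
proof -
  let ?J = "{..<N}"
  define L where "L = l1norm ?J (trigsum F c p)"
  define Q where "Q = l1norm ?J (trigsum {k \<in> F. card (supp (p k)) = m} c p)"
  define Col where "Col = {..<N} \<rightarrow>\<^sub>E {..<m}"
  define R where "R col = {k \<in> F. \<forall>j<m. card (supp (p k) \<inter> col -` {j}) = 1}" for col :: "nat \<Rightarrow> nat"
  have [simp]: "finite Col" unfolding Col_def by (intro finite_PiE) auto
  have cardCol: "card Col = m ^ N" unfolding Col_def by (simp add: card_funcsetE)
  have S: "supp (p k) \<subseteq> ?J" if "k \<in> F" for k using p[OF that] by (auto simp: amindex_def mindex_def)
  have "Q \<le> exp 1 ^ (m - 1) * K1 ^ m * L"
  proof (cases "m \<le> N")
    case True
    define W where "W = m ^ (N - m) * fact m"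
    have "(\<Sum>col\<in>Col. trigsum (R col) c p t) = of_nat W * trigsum {k \<in> F. card (supp (p k)) = m} c p t" for t
    proof -
      have "(\<Sum>col\<in>Col. trigsum (R col) c p t)
          = (\<Sum>col\<in>Col. \<Sum>k\<in>F. if k \<in> R col then c k * character (p k) t else 0)"
      proof (intro sum.cong refl)
        fix col
        have "F \<inter> R col = R col" by (auto simp: R_def)
        thus "trigsum (R col) c p t = (\<Sum>k\<in>F. if k \<in> R col then c k * character (p k) t else 0)"
          unfolding trigsum_def using sum.inter_restrict[OF assms(1), of _ "R col"] by metis
      qed
      also have "\<dots> = (\<Sum>k\<in>F. \<Sum>col\<in>Col. if k \<in> R col then c k * character (p k) t else 0)"
        by (rule sum.swap)
      also have "\<dots> = (\<Sum>k\<in>F. of_nat (card {col \<in> Col. k \<in> R col}) * (c k * character (p k) t))"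
        by (intro sum.cong refl) (simp flip: sum.inter_filter)
      also have "\<dots> = (\<Sum>k\<in>F. if card (supp (p k)) = m then of_nat W * (c k * character (p k) t) else 0)"
      proof (intro sum.cong refl)
        fix k assume k: "k \<in> F"
        hence "{col \<in> Col. k \<in> R col} = {col \<in> Col. \<forall>j<m. card (supp (p k) \<inter> col -` {j}) = 1}"
          by (auto simp: R_def)
        hence "card {col \<in> Col. k \<in> R col} = (if card (supp (p k)) = m then W else 0)"
          unfolding Col_def W_def card_rainbow[OF S[OF k], symmetric] by simp
        thus "of_nat (card {col \<in> Col. k \<in> R col}) * (c k * character (p k) t)
            = (if card (supp (p k)) = m then of_nat W * (c k * character (p k) t) else 0)"
          by simp
      qed
      also have "\<dots> = of_nat W * trigsum {k \<in> F. card (supp (p k)) = m} c p t"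
        unfolding trigsum_def sum_distrib_left using assms(1) by (simp add: sum.inter_filter)
      finally show ?thesis .
    qed
    hence "real W * Q = l1norm ?J (\<lambda>t. \<Sum>col\<in>Col. trigsum (R col) c p t)"
      unfolding Q_def l1norm_def by (simp add: norm_mult)
    also have "\<dots> \<le> (\<Sum>col\<in>Col. l1norm ?J (trigsum (R col) c p))"
      using p by (intro l1norm_sum_le integrable_trigsum amindex_imp_mindex) (auto simp: R_def)
    also have "\<dots> \<le> (\<Sum>col\<in>Col. K1 ^ m * L)"
      unfolding R_def L_def using assms(1) p by (intro sum_mono l1norm_P1_blocks_le) auto
    \<comment> \<open>Because m \<le> N, the number m^N of colourings splits so that m^(N-m) cancels
      against \<open>W\<close> and m^m / m! remains.\<close>
    also have "\<dots> = real m ^ (N - m) * (real m ^ m * (K1 ^ m * L))"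
      using True by (simp add: cardCol flip: power_add mult.assoc)
    also have "\<dots> \<le> real m ^ (N - m) * (exp 1 ^ (m - 1) * fact m * (K1 ^ m * L))"
      using power_self_le_fact[OF m] K1_nonneg
      by (intro mult_left_mono mult_right_mono) (auto simp: L_def)
    finally have "(real m ^ (N - m) * fact m) * Q \<le> (real m ^ (N - m) * fact m) * (exp 1 ^ (m - 1) * K1 ^ m * L)"
      unfolding W_def by (simp add: mult_ac)
    thus ?thesis
      by (rule mult_left_le_imp_le) (use m in auto)
  next
    case False
    have "card (supp (p k)) \<le> N" if "k \<in> F" for k
      using card_mono[OF _ S[OF that]] by simp
    hence "{k \<in> F. card (supp (p k)) = m} = {}" using False by fastforce
    hence "Q = 0" unfolding Q_def by (simp only:) (simp add: trigsum_def l1norm_def)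
    thus ?thesis using K1_nonneg by (simp add: L_def)
  qed
  also have "exp 1 ^ (m - 1) * K1 ^ m = (1 / exp 1) * (exp 1 * K1) ^ m"
    using m by (cases m) (auto simp: power_mult_distrib)
  finally show ?thesis unfolding Q_def L_def .
qed

section \<open>Passing from finitely to infinitely many variables\<close>

lemma l1norm_trigsum_restrict:
  assumes "finite J" "J \<subseteq> I" "\<And>k. k \<in> F \<Longrightarrow> p k \<in> mindex J"
  shows "l1norm I (trigsum F c p) = l1norm J (trigsum F c p)"
  unfolding l1norm_def
proof (rule integral_torus_restrict[OF assms(1,2)])
  have [measurable]: "trigsum F c p \<in> borel_measurable (torus J)"
    using assms(3) by (rule measurable_trigsum)
  show "(\<lambda>t. norm (trigsum F c p t)) \<in> borel_measurable (torus J)" by measurable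
  show "norm (trigsum F c p (restrict t J)) = norm (trigsum F c p t)" for t
    unfolding trigsum_def using assms(3) by (intro arg_cong[of _ _ norm] sum.cong) (auto simp: character_restrict mindexD)
qed

text \<open>A polynomial on the infinite torus involves only finitely many variables, and neither
  norm changes when the others are dropped.\<close>

lemma l1norm_Pm_le_torus:
  fixes F :: "'k set"
  assumes I: "I \<in> range lessThan \<union> {UNIV}"
    and F: "finite F" "\<And>k. k \<in> F \<Longrightarrow> p k \<in> amindex I" and m: "m \<ge> 1"
  shows "l1norm I (trigsum {k \<in> F. card (supp (p k)) = m} c p)
           \<le> (1 / exp 1) * (exp 1 * K1) ^ m * l1norm I (trigsum F c p)"
proof (cases "I = UNIV")
  case True
  have "finite (\<Union>k\<in>F. supp (p k))"
    using F by (auto simp: amindex_def mindex_def)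
  then obtain N where N: "(\<Union>k\<in>F. supp (p k)) \<subseteq> {..<N}"
    using finite_nat_iff_bounded by blast
  have p: "p k \<in> amindex {..<N}" if "k \<in> F" for k
    using F(2)[OF that] N that by (auto simp: amindex_def mindex_def)
  have "l1norm I (trigsum G c p) = l1norm {..<N} (trigsum G c p)" if "G \<subseteq> F" for G
    using True p that by (intro l1norm_trigsum_restrict amindex_imp_mindex) auto
  thus ?thesis using l1norm_Pm_le[OF F(1) p m, of "\<lambda>k. k" c] by simp
next
  case False
  then obtain N where "I = {..<N}" using I by auto
  thus ?thesis using l1norm_Pm_le[OF F(1) _ m, of p N c] F(2) by simp
qed

section \<open>Extension to the Hardy space\<close>

text \<open>Riesz-Fischer by telescoping: the series of differences converges absolutely almost
  everywhere, and the sum of their norms dominates the remainders.\<close>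

lemma L1_complete:
  fixes u :: "nat \<Rightarrow> 'a \<Rightarrow> complex"
  assumes u: "\<And>k. integrable M (u k)" and sm: "summable (\<lambda>k. LINT x|M. norm (u (Suc k) x - u k x))"
  obtains g where "integrable M g" "(\<lambda>k. LINT x|M. norm (g x - u k x)) \<longlonglongrightarrow> 0"
proof -
  define d where "d k x = u (Suc k) x - u k x" for k x
  have d: "integrable M (d k)" for k unfolding d_def using u by simp
  have sm': "summable (\<lambda>k. LINT x|M. norm (d k x))" using sm by (simp add: d_def)
  have AE: "AE x in M. summable (\<lambda>k. norm (d k x))"
  proof -
    have [measurable]: "d k \<in> borel_measurable M" for k using d by auto
    have "(\<integral>\<^sup>+x. (\<Sum>k. ennreal (norm (d k x))) \<partial>M) = (\<Sum>k. \<integral>\<^sup>+x. ennreal (norm (d k x)) \<partial>M)"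
      by (intro nn_integral_suminf) auto
    also have "\<dots> = (\<Sum>k. ennreal (LINT x|M. norm (d k x)))"
      using d by (intro suminf_cong nn_integral_eq_integral) auto
    also have "\<dots> = ennreal (\<Sum>k. LINT x|M. norm (d k x))"
      using sm' by (intro suminf_ennreal_eq summable_sums) auto
    finally have "(\<integral>\<^sup>+x. (\<Sum>k. ennreal (norm (d k x))) \<partial>M) \<noteq> \<infinity>" by simp
    hence "AE x in M. (\<Sum>k. ennreal (norm (d k x))) \<noteq> \<infinity>"
      by (intro nn_integral_PInf_AE) auto
    thus ?thesis by eventually_elim (auto intro: summable_suminf_not_top)
  qed
  define g where "g x = u 0 x + (\<Sum>k. d k x)" for x
  define w where "w x = (\<Sum>k. norm (d k x))" for x
  have g: "integrable M g"
    unfolding g_def using u d AE sm' by (intro Bochner_Integration.integrable_add integrable_suminf) auto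
  have w: "integrable M w"
    unfolding w_def using d AE sm' by (intro integrable_suminf) auto
  have tel: "u n x = u 0 x + (\<Sum>k<n. d k x)" for n x
    by (induction n) (auto simp: d_def)
  have "(\<lambda>n. LINT x|M. norm (g x - u n x)) \<longlonglongrightarrow> (LINT x|M. 0)"
  proof (rule integral_dominated_convergence[where w = w])
    show "AE x in M. (\<lambda>n. norm (g x - u n x)) \<longlonglongrightarrow> 0"
      using AE
    proof eventually_elim
      case (elim x)
      have "(\<lambda>n. \<Sum>k<n. d k x) \<longlonglongrightarrow> (\<Sum>k. d k x)"
        using summable_norm_cancel[OF elim] by (rule summable_LIMSEQ)
      hence "(\<lambda>n. norm ((\<Sum>k. d k x) - (\<Sum>k<n. d k x))) \<longlonglongrightarrow> norm ((\<Sum>k. d k x) - (\<Sum>k. d k x))"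
        by (intro tendsto_intros)
      thus ?case by (subst tel) (simp add: g_def)
    qed
    show "AE x in M. norm (norm (g x - u n x)) \<le> w x" for n
      using AE
    proof eventually_elim
      case (elim x)
      have "g x - u n x = (\<Sum>k. d (k + n) x)"
        using suminf_minus_initial_segment[OF summable_norm_cancel[OF elim], of n]
        by (subst tel) (simp add: g_def)
      also have "norm \<dots> \<le> (\<Sum>k. norm (d (k + n) x))"
        using elim summable_iff_shift[of "\<lambda>k. norm (d k x)" n] by (intro summable_norm) simp
      also have "\<dots> = w x - (\<Sum>k<n. norm (d k x))"
        unfolding w_def by (rule suminf_minus_initial_segment[OF elim])
      also have "\<dots> \<le> w x" by (simp add: sum_nonneg)
      finally show ?case by simp
    qed
  qed (use g u w in auto)
  thus ?thesis using that g by simp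
qed

text \<open>Keeping a difference in the form of a \<open>trigsum\<close> makes the bound for P_m
  applicable to it, so that P_m preserves Cauchy sequences of polynomials.\<close>

lemma trigsum_diff:
  assumes "finite F" "finite G"
  shows "trigsum F c p t - trigsum G d q t
    = trigsum (F <+> G) (case_sum c (\<lambda>k. - d k)) (case_sum p q) t"
  using assms by (simp add: trigsum_def sum.Plus sum_negf)

lemma norm_fourier_diff_le:
  assumes "integrable (torus I) f" "integrable (torus I) g" "n \<in> mindex I"
  shows "norm (fourier I f n - fourier I g n) \<le> l1norm I (\<lambda>t. f t - g t)"
proof -
  have "norm (fourier I f n - fourier I g n) = norm (LINT t|torus I. (f t - g t) * cnj (character n t))"
    using fourier_diff[OF assms] by (simp add: fourier_def)
  also have "\<dots> \<le> (LINT t|torus I. norm ((f t - g t) * cnj (character n t)))"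
    by (rule integral_norm_bound)
  finally show ?thesis by (simp add: l1norm_def norm_mult)
qed

lemma l1norm_triangle:
  assumes "integrable (torus I) f" "integrable (torus I) g"
  shows "l1norm I (\<lambda>t. f t + g t) \<le> l1norm I f + l1norm I g"
proof -
  have "l1norm I (\<lambda>t. f t + g t) \<le> (LINT t|torus I. norm (f t) + norm (g t))"
    unfolding l1norm_def using assms by (intro integral_mono) (auto intro: norm_triangle_ineq)
  thus ?thesis unfolding l1norm_def using assms by simp
qed

lemma H1_imp_Pm:
  assumes I: "I \<in> range lessThan \<union> {UNIV}" and f: "f \<in> H1 I" and m: "m \<ge> 1"
  shows "\<exists>g\<in>H1 I. is_Pm I m f g \<and> l1norm I g \<le> (1 / exp 1) * (exp 1 * K1) ^ m * l1norm I f"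
proof -
  define C where "C = (1 / exp 1) * (exp 1 * K1) ^ m"
  have C: "C \<ge> 0" unfolding C_def using K1_nonneg by simp
  have fi: "integrable (torus I) f" using f by (simp add: H1_def)
  \<comment> \<open>The geometric rate makes the norms of consecutive differences summable, as
    \<open>L1_complete\<close> requires.\<close>
  have "\<exists>F c. finite F \<and> F \<subseteq> amindex I \<and> l1norm I (\<lambda>t. f t - trigsum F c (\<lambda>n. n) t) < (1/2) ^ k" for k :: nat
  proof -
    obtain p where p: "apoly I p" "l1norm I (\<lambda>t. f t - p t) < (1/2) ^ k"
      using f unfolding H1_def by (auto dest!: spec[of _ "(1/2) ^ k"])
    obtain F c where F: "finite F" "F \<subseteq> amindex I" "\<And>t. t \<in> space (torus I) \<Longrightarrow> p t = trigsum F c (\<lambda>n. n) t"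
      using p(1) by (auto simp: apoly_def trigsum_def)
    have "l1norm I (\<lambda>t. f t - trigsum F c (\<lambda>n. n) t) = l1norm I (\<lambda>t. f t - p t)"
      using F(3) by (intro l1norm_cong) auto
    thus ?thesis using F(1,2) p(2) by (intro exI[of _ F] exI[of _ c]) simp
  qed
  then obtain F c where Fc: "\<And>k::nat. finite (F k)" "\<And>k. F k \<subseteq> amindex I"
      "\<And>k. l1norm I (\<lambda>t. f t - trigsum (F k) (c k) (\<lambda>n. n) t) < (1/2) ^ k"
    by metis
  have mem: "n \<in> amindex I" "n \<in> mindex I" if "n \<in> F k" for n k
    using Fc(2)[of k] that by (auto simp: amindex_def)
  define p where "p k = trigsum (F k) (c k) (\<lambda>n. n)" for k
  define G where "G k = {n \<in> F k. card (supp n) = m}" for k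
  define q where "q k = trigsum (G k) (c k) (\<lambda>n. n)" for k
  have pi: "integrable (torus I) (p k)" and qi: "integrable (torus I) (q k)" for k
    unfolding p_def q_def G_def using mem by (auto intro!: integrable_trigsum)
  have fp: "l1norm I (\<lambda>t. f t - p k t) < (1/2) ^ k" for k
    unfolding p_def by (rule Fc(3))
  have fp0: "(\<lambda>k. l1norm I (\<lambda>t. f t - p k t)) \<longlonglongrightarrow> 0"
    by (rule tendsto_sandwich[OF _ _ tendsto_const LIMSEQ_power_zero[of "1/2::real"]])
      (auto intro!: always_eventually less_imp_le fp)
  have P: "is_Pm I m (p k) (q k)" for k
    unfolding p_def q_def G_def using Fc(1) mem by (intro is_Pm_trigsum) auto
  have qp: "l1norm I (q k) \<le> C * l1norm I (p k)" for k
    unfolding p_def q_def G_def C_def using Fc(1) mem m by (intro l1norm_Pm_le_torus[OF I]) auto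
  have diff: "l1norm I (\<lambda>t. q (Suc k) t - q k t) \<le> C * l1norm I (\<lambda>t. p (Suc k) t - p k t)" for k
  proof -
    let ?p = "case_sum (\<lambda>n. n) (\<lambda>n. n) :: (nat \<Rightarrow> int) + (nat \<Rightarrow> int) \<Rightarrow> _"
    let ?c = "case_sum (c (Suc k)) (\<lambda>n. - c k n)"
    have "G (Suc k) <+> G k = {n \<in> F (Suc k) <+> F k. card (supp (?p n)) = m}"
      by (auto simp: G_def)
    moreover have "l1norm I (trigsum {n \<in> F (Suc k) <+> F k. card (supp (?p n)) = m} ?c ?p)
        \<le> C * l1norm I (trigsum (F (Suc k) <+> F k) ?c ?p)"
      unfolding C_def using Fc(1) mem m by (intro l1norm_Pm_le_torus[OF I]) auto
    ultimately show ?thesis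
      using Fc(1) by (simp add: p_def q_def trigsum_diff G_def)
  qed
  have "l1norm I (\<lambda>t. q (Suc k) t - q k t) \<le> 2 * C * (1/2) ^ k" for k
  proof -
    have "l1norm I (\<lambda>t. (f t - p k t) + (- 1) * (f t - p (Suc k) t))
        \<le> l1norm I (\<lambda>t. f t - p k t) + l1norm I (\<lambda>t. (- 1) * (f t - p (Suc k) t))"
      using fi pi by (intro l1norm_triangle) auto
    also have "l1norm I (\<lambda>t. (- 1) * (f t - p (Suc k) t)) = l1norm I (\<lambda>t. f t - p (Suc k) t)"
      unfolding l1norm_def norm_mult by simp
    also have "l1norm I (\<lambda>t. f t - p k t) + l1norm I (\<lambda>t. f t - p (Suc k) t) \<le> 2 * (1/2) ^ k"
      using fp[of k] fp[of "Suc k"] power_decreasing[of k "Suc k" "1/2::real"] by linarith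
    finally have "C * l1norm I (\<lambda>t. p (Suc k) t - p k t) \<le> C * (2 * (1/2) ^ k)"
      using C by (intro mult_left_mono) auto
    thus ?thesis using diff[of k] by (simp add: mult_ac)
  qed
  hence "summable (\<lambda>k. l1norm I (\<lambda>t. q (Suc k) t - q k t))"
    by (intro summable_comparison_test'[OF summable_mult[OF summable_geometric]]) auto
  then obtain g where g: "integrable (torus I) g" "(\<lambda>k. l1norm I (\<lambda>t. g t - q k t)) \<longlonglongrightarrow> 0"
    using L1_complete[of "torus I" q, OF qi] unfolding l1norm_def by blast
  have "g \<in> H1 I"
    unfolding H1_def
  proof (intro CollectI conjI allI impI g)
    fix \<epsilon> :: real assume "\<epsilon> > 0"
    hence "eventually (\<lambda>k. l1norm I (\<lambda>t. g t - q k t) < \<epsilon>) sequentially"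
      using order_tendstoD(2)[OF g(2)] by simp
    then obtain k where "l1norm I (\<lambda>t. g t - q k t) < \<epsilon>"
      by (auto simp: eventually_sequentially)
    moreover have "apoly I (q k)"
      unfolding q_def G_def using Fc(1) mem by (intro apoly_trigsum) auto
    ultimately show "\<exists>p. apoly I p \<and> l1norm I (\<lambda>t. g t - p t) < \<epsilon>" by blast
  qed
  moreover have "is_Pm I m f g"
    unfolding is_Pm_def
  proof (intro conjI ballI g)
    fix n assume n: "n \<in> mindex I"
    let ?T = "\<lambda>z::complex. if card (supp n) = m then z else 0"
    \<comment> \<open>Each Fourier coefficient is continuous for the L^1 norm, so the multiplier
      identity passes from the polynomials to the limit.\<close>
    have "(\<lambda>k. fourier I f n - fourier I (p k) n) \<longlonglongrightarrow> 0"
      by (rule Lim_null_comparison[OF _ fp0]) (intro always_eventually allI norm_fourier_diff_le fi pi n)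
    hence "(\<lambda>k. fourier I f n - (fourier I f n - fourier I (p k) n)) \<longlonglongrightarrow> fourier I f n - 0"
      by (intro tendsto_intros)
    hence "(\<lambda>k. ?T (fourier I (p k) n)) \<longlonglongrightarrow> ?T (fourier I f n)"
      by simp
    moreover have "fourier I (q k) n = ?T (fourier I (p k) n)" for k
      using P[of k] n by (simp add: is_Pm_def)
    ultimately have "(\<lambda>k. fourier I (q k) n) \<longlonglongrightarrow> ?T (fourier I f n)"
      by simp
    moreover have "(\<lambda>k. fourier I g n - fourier I (q k) n) \<longlonglongrightarrow> 0"
      by (rule Lim_null_comparison[OF _ g(2)]) (intro always_eventually allI norm_fourier_diff_le g(1) qi n)
    hence "(\<lambda>k. fourier I g n - (fourier I g n - fourier I (q k) n)) \<longlonglongrightarrow> fourier I g n - 0"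
      by (intro tendsto_intros)
    hence "(\<lambda>k. fourier I (q k) n) \<longlonglongrightarrow> fourier I g n"
      by simp
    ultimately show "fourier I g n = ?T (fourier I f n)"
      using LIMSEQ_unique by blast
  qed
  moreover have "l1norm I g \<le> C * l1norm I f"
  \<comment> \<open>The estimate is proved for every k with error terms tending to 0, so the
    constant of the polynomials is kept in the limit.\<close>
  proof (rule LIMSEQ_le_const)
    show "(\<lambda>k. l1norm I (\<lambda>t. g t - q k t) + C * (l1norm I f + l1norm I (\<lambda>t. f t - p k t))) \<longlonglongrightarrow> C * l1norm I f"
    proof -
      have "(\<lambda>k. l1norm I (\<lambda>t. g t - q k t) + C * (l1norm I f + l1norm I (\<lambda>t. f t - p k t)))
          \<longlonglongrightarrow> 0 + C * (l1norm I f + 0)"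
        by (intro tendsto_intros g(2) fp0)
      thus ?thesis by simp
    qed
    have "l1norm I g \<le> l1norm I (\<lambda>t. g t - q k t) + C * (l1norm I f + l1norm I (\<lambda>t. f t - p k t))" for k
    proof -
      have "l1norm I g \<le> l1norm I (\<lambda>t. g t - q k t) + l1norm I (q k)"
        using l1norm_triangle[of I "\<lambda>t. g t - q k t" "q k"] g(1) qi[of k] by simp
      moreover have "l1norm I (p k) \<le> l1norm I f + l1norm I (\<lambda>t. (- 1) * (f t - p k t))"
        using l1norm_triangle[of I f "\<lambda>t. (- 1) * (f t - p k t)"] fi pi[of k] by simp
      moreover have "l1norm I (\<lambda>t. (- 1) * (f t - p k t)) = l1norm I (\<lambda>t. f t - p k t)"
        unfolding l1norm_def norm_mult by simp
      ultimately have "l1norm I g \<le> l1norm I (\<lambda>t. g t - q k t) + l1norm I (q k)"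
        "l1norm I (p k) \<le> l1norm I f + l1norm I (\<lambda>t. f t - p k t)" by auto
      moreover from this(2) C have "C * l1norm I (p k) \<le> C * (l1norm I f + l1norm I (\<lambda>t. f t - p k t))"
        by (rule mult_left_mono)
      ultimately show ?thesis using qp[of k] by linarith
    qed
    thus "\<exists>N. \<forall>k\<ge>N. l1norm I g \<le> l1norm I (\<lambda>t. g t - q k t) + C * (l1norm I f + l1norm I (\<lambda>t. f t - p k t))"
      by blast
  qed
  ultimately show ?thesis unfolding C_def by blast
qed

theorem theorem4p5:
  shows "K_P1 < \<infinity> \<and>
    (\<forall>m::nat. m \<ge> 1 \<longrightarrow>
      (\<forall>I \<in> range lessThan \<union> {UNIV}. \<forall>f \<in> H1 I.
         \<exists>g \<in> H1 I. is_Pm I m f g \<and>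
           l1norm I g \<le> (1 / exp 1) * (exp 1 * real_of_ereal K_P1) ^ m * l1norm I f))"
proof (intro conjI allI impI ballI)
  show "K_P1 < \<infinity>"
    using K_P1_le by (rule order.strict_trans1) simp
next
  fix m :: nat and I f
  assume "1 \<le> m" "I \<in> range lessThan \<union> {UNIV}" "f \<in> H1 I"
  thus "\<exists>g\<in>H1 I. is_Pm I m f g \<and>
      l1norm I g \<le> (1 / exp 1) * (exp 1 * real_of_ereal K_P1) ^ m * l1norm I f"
    by (intro H1_imp_Pm)
qed

end
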